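(* Let $k\ge 1$ be the number of sites and $\varepsilon>0$ with $\varepsilon\le 1/\sqrt{k}$. There exist universal constants $c_1,c_2,c_3>0$ and an adaptive adversary generating the event stream for the HYZ12 protocol (described in the context) such that for every event count $n>c_3\sqrt{k}/\varepsilon$, the server's published estimate $\hat n$ after the $n$-th event satisfies \[ \Pr\!\left[\hat n-n> c_1\sqrt{k}\,\varepsilon\, n\right]\;\ge\;1-e^{-c_2 k}, \] where the probability is over the protocol's internal randomness.
   Context: Distributed counting: a server and $k$ sites; events arrive one at a time, each at some site; $n_i$ is the number of events at site $i$ so far and $n=\sum_i n_i$. The server continuously publishes an estimate $\hat n$ of $n$. An adaptive adversary chooses the site of each next event as a function of all previously published estimates. ${\rm Geom}(q)$ denotes the geometric distribution on $\{1,2,\dots\}$ with $\Pr(G=j)=(1-q)^{j-1}q$. Doubling subprotocol (runs on the same stream): each site, after incrementing $n_i$, sends $(i,n_i)$ to the server whenever $n_i$ is a power of $2$. The server keeps $n'_i$ (last value received from site $i$, initially $0$), $n'=\sum_i n'_i$, and a threshold $\tau=1$; upon receiving $(i,n_i)$ it sets $n'\gets n'+n_i-n'_i$, $n'_i\gets n_i$, and if $n'\ge 2\tau$ it triggers the signal BoundaryReached$(n')$ and sets $\tau\gets n'$. HYZ12 protocol: each site $i$ keeps a transmission probability $p$ (initially $1$, updated by server broadcasts) and its count $n_i$. On each event at site $i$: $n_i\gets n_i+1$, and independently with probability $p$ the site sends Report$(i,n_i)$. The server keeps, for each $i$, $\bar n_i=0$ and $\hat n_i=0$, and $p=1$. Upon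 receiving Report$(i,\bar n)$ it sets $\bar n_i\gets \bar n$, $\hat n_i\gets \bar n_i-1+1/p$ and publishes $\hat n=\sum_j\hat n_j$. Upon BoundaryReached$(n')$ (if an event triggers both, the report is processed first): $p_{\rm old}\gets p$, $p\gets 2^{\min\{0,\lfloor\log_2(\sqrt{k}/(\varepsilon n'))\rfloor\}}$; if $p<1$, then for each site $i$ it independently samples $Z_i=B\cdot G$ with $B\sim{\rm Bernoulli}(1-p/p_{\rm old})$ and $G\sim{\rm Geom}(p)$ independent, sets $\bar n_i\gets\max\{0,\bar n_i-Z_i\}$, sets $\hat n_i\gets 0$ if $\bar n_i=0$ and $\hat n_i\gets\bar n_i-1+1/p$ otherwise, and broadcasts $p$ to all sites. *)

theory Defs
  imports "HOL-Probability.Probability"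
begin

text \<open>Joint state of the HYZ12 protocol and the doubling subprotocol.
  Sites are indexed by 0..<k.  The sites' transmission probability always
  equals the server's p (it is broadcast whenever it changes), so only one p is kept.\<close>

record hyz_state =
  cnt   :: "nat \<Rightarrow> nat"
  dlast :: "nat \<Rightarrow> nat"
  dsum  :: nat
  tau   :: nat
  prob  :: real
  nbar  :: "nat \<Rightarrow> nat"
  nhat  :: "nat \<Rightarrow> real"
  pub   :: real

definition hyz_init :: hyz_state where
  "hyz_init = \<lparr> cnt = (\<lambda>_. 0), dlast = (\<lambda>_. 0), dsum = 0, tau = 1, prob = 1,
                nbar = (\<lambda>_. 0), nhat = (\<lambda>_. 0), pub = 0 \<rparr>"

definition geom1_pmf :: "real \<Rightarrow> nat pmf" where
  "geom1_pmf q = map_pmf Suc (geometric_pmf q)"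

definition Z_pmf :: "real \<Rightarrow> real \<Rightarrow> nat pmf" where
  "Z_pmf p pold = do { b \<leftarrow> bernoulli_pmf (1 - p / pold); g \<leftarrow> geom1_pmf p;
                       return_pmf (if b then g else 0) }"

definition new_prob :: "nat \<Rightarrow> real \<Rightarrow> nat \<Rightarrow> real" where
  "new_prob k \<epsilon> n' = 2 powr (real_of_int (min 0 \<lfloor>log 2 (sqrt (real k) / (\<epsilon> * real n'))\<rfloor>))"

definition boundary :: "nat \<Rightarrow> real \<Rightarrow> nat \<Rightarrow> hyz_state \<Rightarrow> hyz_state pmf" where
  "boundary k \<epsilon> n' s =
     (let pold = prob s; p = new_prob k \<epsilon> n' in
      if p < 1 then
        map_pmf (\<lambda>Z. let nb = (\<lambda>i. nbar s i - Z i) in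
                   s\<lparr> prob := p, nbar := nb,
                      nhat := (\<lambda>i. if nb i = 0 then 0 else real (nb i) - 1 + 1 / p) \<rparr>)
          (Pi_pmf {..<k} 0 (\<lambda>_. Z_pmf p pold))
      else return_pmf (s\<lparr> prob := p \<rparr>))"

definition report :: "nat \<Rightarrow> nat \<Rightarrow> hyz_state \<Rightarrow> hyz_state" where
  "report k i s =
     (let nh = (nhat s)(i := real (cnt s i) - 1 + 1 / prob s) in
      s\<lparr> nbar := (nbar s)(i := cnt s i), nhat := nh, pub := (\<Sum>j<k. nh j) \<rparr>)"

definition doubling :: "nat \<Rightarrow> real \<Rightarrow> nat \<Rightarrow> hyz_state \<Rightarrow> hyz_state pmf" where
  "doubling k \<epsilon> i s =
     (if (\<exists>m. cnt s i = 2 ^ m) then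
        (let n' = dsum s + cnt s i - dlast s i;
             s1 = s\<lparr> dsum := n', dlast := (dlast s)(i := cnt s i) \<rparr> in
         if n' \<ge> 2 * tau s then map_pmf (\<lambda>t. t\<lparr> tau := n' \<rparr>) (boundary k \<epsilon> n' s1)
         else return_pmf s1)
      else return_pmf s)"

definition hyz_step :: "nat \<Rightarrow> real \<Rightarrow> nat \<Rightarrow> hyz_state \<Rightarrow> hyz_state pmf" where
  "hyz_step k \<epsilon> i s =
     (let s1 = s\<lparr> cnt := (cnt s)(i := cnt s i + 1) \<rparr> in
      do { b \<leftarrow> bernoulli_pmf (prob s1);
           doubling k \<epsilon> i (if b then report k i s1 else s1) })"

fun hyz_run :: "nat \<Rightarrow> real \<Rightarrow> (real list \<Rightarrow> nat) \<Rightarrow> nat \<Rightarrow> (hyz_state \<times> real list) pmf" where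
  "hyz_run k \<epsilon> adv 0 = return_pmf (hyz_init, [])"
| "hyz_run k \<epsilon> adv (Suc m) =
     bind_pmf (hyz_run k \<epsilon> adv m) (\<lambda>(s, h).
       map_pmf (\<lambda>s'. (s', h @ [pub s'])) (hyz_step k \<epsilon> (adv h) s))"

end

theory Submission
  imports Defs
begin

text \<open>
  The adversary runs round robin over \<open>m\<close> sites and leaves a site as soon as the published value
  changes, that is, as soon as the site has reported.  Immediately after a report the estimate of a
  site is too large by \<open>1 / p - 1\<close>, and since the site then receives no events, its error
  only changes by the resampling at boundaries, which is unbiased.  For \<open>m\<close> a small fraction
  of \<open>k\<close>, all \<open>m\<close> sites are visited during the last \<open>n / 2\<close> events, so the
  history before that window is irrelevant; during the window \<open>tau\<close> at least doubles at each boundary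
  but grows by a factor at most 8, so \<open>p\<close> stays of the order \<open>sqrt k / (\<epsilon> * n)\<close>
  and there are at most three boundaries.  The overestimate is thus of the order \<open>m / p\<close>,
  unless the last report is too old, too few sites are visited, or the resampling noise is large.
  Each of these three events is exponentially unlikely in \<open>k\<close>, by a supermartingale argument.
  For bounded \<open>k\<close> a constant probability suffices and a single site is used.
\<close>

subsection \<open>Resampling\<close>

text \<open>The server's estimate of one site from its recorded count. The value 0 at count 0 is
  what makes resampling with truncation exactly unbiased.\<close>

definition est :: "real \<Rightarrow> nat \<Rightarrow> real" where
  "est p b = (if b = 0 then 0 else real b - 1 + 1 / p)"

text \<open>The product of \<open>1 - x + x^2 / 2\<close> and \<open>1 + x + x^2 / 2\<close> is
  \<open>1 + x^4 / 4\<close>, so the lower Taylor bound for \<open>exp x\<close> inverts to this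
  upper bound.\<close>

lemma exp_minus_le_quadratic:
  fixes x :: real
  assumes "0 \<le> x"
  shows "exp (- x) \<le> 1 - x + x\<^sup>2 / 2"
proof (cases "x = 0")
  case False
  have e: "1 + x + x\<^sup>2 / 2 \<le> exp x" using exp_lower_Taylor_quadratic[of x] assms by simp
  have nn: "0 \<le> 1 - x + x\<^sup>2 / 2"
    using zero_le_power2[of "x - 1"] by (simp add: power2_eq_square algebra_simps)
  have "1 \<le> 1 + x ^ 4 / 4" by simp
  also have "\<dots> = (1 - x + x\<^sup>2 / 2) * (1 + x + x\<^sup>2 / 2)"
    by (simp add: field_simps power2_eq_square power4_eq_xxxx)
  also have "\<dots> \<le> (1 - x + x\<^sup>2 / 2) * exp x" by (rule mult_left_mono[OF e nn])
  finally have "(1 - x + x\<^sup>2 / 2) * exp x \<ge> 1" .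
  then show ?thesis by (simp add: exp_minus divide_simps)
qed simp

text \<open>Condition on the first trial of the geometric variable: a success removes exactly one
  unit, a failure leaves the same problem for a count smaller by one. The mean of the estimate after
  a geometric drop is \<open>n - 1\<close>, and \<open>C\<close> accounts for the second-order
  excess.\<close>

lemma nn_integral_geom1_est:
  fixes a \<theta> :: real
  assumes a: "0 < a" "a \<le> 1" and th: "0 \<le> \<theta>" "\<theta> < a" and n: "n \<ge> 1"
  defines "C \<equiv> exp (- (\<theta> / a)) / (1 - \<theta> / a)"
  shows "(\<integral>\<^sup>+j. ennreal (exp (- \<theta> * est a (n - j))) \<partial>geom1_pmf a)
           \<le> ennreal (C * exp (- \<theta> * (real n - 1)))"
  using n
proof (induction n rule: dec_induct)
  case base
  have x: "\<theta> / a < 1" using a th by simp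
  have "1 - \<theta> / a \<le> exp (- (\<theta> / a))" using exp_ge_add_one_self[of "- (\<theta> / a)"] by simp
  then have "1 \<le> C" using x by (simp add: C_def)
  then show ?case
    by (simp add: geom1_pmf_def est_def ennreal_ge_1)
next
  case (step n)
  have x: "\<theta> / a < 1" using a th by simp
  have C0: "C \<ge> 0" using x by (simp add: C_def)
  have unf: "geometric_pmf a = bernoulli_pmf a \<bind> (\<lambda>b. if b then return_pmf 0 else map_pmf Suc (geometric_pmf a))"
    by (rule geometric_bind_pmf_unfold) (use a in auto)
  have "(\<integral>\<^sup>+j. ennreal (exp (- \<theta> * est a (Suc n - j))) \<partial>geom1_pmf a) =
        (\<integral>\<^sup>+j. ennreal (exp (- \<theta> * est a (n - j))) \<partial>geometric_pmf a)"
    by (simp add: geom1_pmf_def)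
  also have "\<dots> = ennreal (exp (- \<theta> * est a n)) * ennreal a +
      (\<integral>\<^sup>+j. ennreal (exp (- \<theta> * est a (n - j))) \<partial>geom1_pmf a) * ennreal (1 - a)"
    by (subst unf) (use a in \<open>simp add: geom1_pmf_def\<close>)
  also have "\<dots> \<le> ennreal (exp (- \<theta> * est a n)) * ennreal a +
      ennreal (C * exp (- \<theta> * (real n - 1))) * ennreal (1 - a)"
    by (intro add_left_mono mult_right_mono step.IH) auto
  also have "\<dots> = ennreal (exp (- \<theta> * est a n) * a + C * exp (- \<theta> * (real n - 1)) * (1 - a))"
    using a C0 by (simp add: ennreal_mult ennreal_plus)
  also have "\<dots> \<le> ennreal (C * exp (- \<theta> * (real (Suc n) - 1)))"
  proof (rule ennreal_leI)
    have e1: "exp (- \<theta> * est a n) = exp (- \<theta> * (real n - 1)) * exp (- (\<theta> / a))"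
      using step.hyps by (simp add: est_def algebra_simps flip: exp_add)
    have e2: "exp (- \<theta> * (real (Suc n) - 1)) = exp (- \<theta> * (real n - 1)) * exp (- \<theta>)"
      by (simp add: algebra_simps flip: exp_add)
    have "1 - \<theta> \<le> exp (- \<theta>)" using exp_ge_add_one_self[of "- \<theta>"] by simp
    then have "C * (1 - \<theta>) \<le> C * exp (- \<theta>)" using C0 by (rule mult_left_mono)
    \<comment> \<open>This identity determines \<open>C\<close>: with it the two branches add up to
      \<open>C * (1 - \<theta>)\<close>.\<close>
    moreover have "exp (- (\<theta> / a)) * a = C * (a - \<theta>)"
      using x a by (simp add: C_def field_simps)
    ultimately have "exp (- (\<theta> / a)) * a + C * (1 - a) \<le> C * exp (- \<theta>)"
      by (simp add: algebra_simps)
    then have "exp (- \<theta> * (real n - 1)) * (exp (- (\<theta> / a)) * a + C * (1 - a))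
        \<le> exp (- \<theta> * (real n - 1)) * (C * exp (- \<theta>))"
      by (rule mult_left_mono) simp
    then show "exp (- \<theta> * est a n) * a + C * exp (- \<theta> * (real n - 1)) * (1 - a)
        \<le> C * exp (- \<theta> * (real (Suc n) - 1))"
      unfolding e1 e2 by (simp add: algebra_simps)
  qed
  finally show ?case .
qed

text \<open>Resampling leaves the estimate of a site unbiased, even with the truncation at 0, so its moment
  generating function only picks up a second-order factor.\<close>

lemma nn_integral_Z_est:
  fixes p pold \<theta> :: real
  assumes p: "0 < p" "p \<le> pold" "p \<le> 1" and th: "0 \<le> \<theta>" "\<theta> \<le> \<mu> * p" and l: "\<mu> \<le> 1 / 2"
  shows "(\<integral>\<^sup>+z. ennreal (exp (- \<theta> * est p (n - z))) \<partial>Z_pmf p pold)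
           \<le> ennreal ((1 + 2 * \<mu>\<^sup>2) * exp (- \<theta> * est pold n))"
proof -
  define x where "x = \<theta> / p"
  have x: "0 \<le> x" "x \<le> \<mu>" using p th unfolding x_def by (auto simp: field_simps)
  then have x_half: "x \<le> 1 / 2" using l by simp
  note x = x x_half
  have thx: "\<theta> = x * p" using p by (simp add: x_def)
  define w where "w = p / pold"
  have w: "0 < w" "w \<le> 1" "1 - w \<ge> 0" using p by (auto simp: w_def)
  define C where "C = exp (- x) / (1 - x)"
  have x2: "x\<^sup>2 \<le> \<mu>\<^sup>2" using x by (intro power_mono) auto
  have split: "(\<integral>\<^sup>+z. ennreal (exp (- \<theta> * est p (n - z))) \<partial>Z_pmf p pold) =
     (\<integral>\<^sup>+z. ennreal (exp (- \<theta> * est p (n - z))) \<partial>geom1_pmf p) * ennreal (1 - w) + ennreal (exp (- \<theta> * est p n)) * ennreal w"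
    using w by (simp add: Z_pmf_def flip: w_def)
  show ?thesis
  proof (cases "n = 0")
    case True
    have "(\<integral>\<^sup>+z. ennreal (exp (- \<theta> * est p (n - z))) \<partial>Z_pmf p pold) = 1"
      using True by (simp add: est_def)
    also have "\<dots> \<le> ennreal ((1 + 2 * \<mu>\<^sup>2) * exp (- \<theta> * est pold n))"
      using True by (simp add: est_def flip: ennreal_1 del: ennreal_1)
    finally show ?thesis .
  next
    case False
    have C0: "C \<ge> 0" using x by (simp add: C_def)
    have e: "exp (- x) \<le> 1 - x + x\<^sup>2 / 2" using x by (intro exp_minus_le_quadratic) auto
    have CC: "C \<le> 1 + x\<^sup>2"
    proof -
      have "x * x\<^sup>2 \<le> (1 / 2) * x\<^sup>2" using x by (intro mult_right_mono) auto
      then have "exp (- x) \<le> (1 + x\<^sup>2) * (1 - x)" using e by (simp add: algebra_simps)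
      then show ?thesis using x by (simp add: C_def divide_simps)
    qed
    have "(\<integral>\<^sup>+z. ennreal (exp (- \<theta> * est p (n - z))) \<partial>geom1_pmf p) \<le> ennreal (C * exp (- \<theta> * (real n - 1)))"
      unfolding C_def x_def
    proof (rule nn_integral_geom1_est)
      show "\<theta> < p" using thx x p by (simp add: )
    qed (use p False th in auto)
    then have "(\<integral>\<^sup>+z. ennreal (exp (- \<theta> * est p (n - z))) \<partial>Z_pmf p pold) \<le>
        ennreal (C * exp (- \<theta> * (real n - 1))) * ennreal (1 - w) + ennreal (exp (- \<theta> * est p n)) * ennreal w"
      unfolding split by (intro add_right_mono mult_right_mono) auto
    also have "\<dots> = ennreal (C * exp (- \<theta> * (real n - 1)) * (1 - w) + exp (- \<theta> * est p n) * w)"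
      using w C0 by (simp add: ennreal_mult ennreal_plus)
    also have "\<dots> \<le> ennreal ((1 + 2 * \<mu>\<^sup>2) * exp (- \<theta> * est pold n))"
    proof (rule ennreal_leI)
      have e1: "exp (- \<theta> * est p n) = exp (- \<theta> * (real n - 1)) * exp (- x)"
        using False p by (simp add: est_def algebra_simps x_def flip: exp_add)
      have "\<theta> / pold = w * x" using p by (simp add: w_def x_def)
      then have e2: "exp (- \<theta> * est pold n) = exp (- \<theta> * (real n - 1)) * exp (- (w * x))"
        using False p by (simp add: est_def algebra_simps flip: exp_add)
      have wx: "w * x \<le> 1 / 2" using w x mult_mono[of w 1 x "1/2"] by simp
      \<comment> \<open>The linear terms of both branches combine to \<open>- w * x\<close>, the
        exponent belonging to \<open>pold\<close>; this is the unbiasedness. What remains is of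
        order \<open>x^2\<close>.\<close>
      have "C * (1 - w) + exp (- x) * w \<le> (1 + x\<^sup>2) * (1 - w) + (1 - x + x\<^sup>2 / 2) * w"
        using CC e w by (intro add_mono mult_right_mono) auto
      also have "\<dots> = 1 - w * x + x\<^sup>2 - w * (x\<^sup>2 / 2)"
        by (simp add: algebra_simps)
      also have "\<dots> \<le> 1 - w * x + x\<^sup>2" using w x by simp
      also have "\<dots> \<le> (1 + 2 * x\<^sup>2) * (1 - w * x)"
        using mult_right_mono[OF wx, of "x\<^sup>2"] by (simp add: algebra_simps)
      also have "\<dots> \<le> (1 + 2 * \<mu>\<^sup>2) * (1 - w * x)" using x2 wx by (intro mult_right_mono) auto
      also have "\<dots> \<le> (1 + 2 * \<mu>\<^sup>2) * exp (- (w * x))"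
        using exp_ge_add_one_self[of "- (w * x)"] by (intro mult_left_mono) auto
      finally have "exp (- \<theta> * (real n - 1)) * (C * (1 - w) + exp (- x) * w) \<le>
          exp (- \<theta> * (real n - 1)) * ((1 + 2 * \<mu>\<^sup>2) * exp (- (w * x)))"
        by (rule mult_left_mono) simp
      then show "C * exp (- \<theta> * (real n - 1)) * (1 - w) + exp (- \<theta> * est p n) * w
          \<le> (1 + 2 * \<mu>\<^sup>2) * exp (- \<theta> * est pold n)"
        unfolding e1 e2 by (simp add: algebra_simps)
    qed
    finally show ?thesis .
  qed
qed

section \<open>Size of the transmission probability and the effect of one boundary\<close>

lemma new_prob_le: 
  assumes "\<epsilon> > 0" "k \<ge> 1" "\<tau> \<ge> 1"
  shows "new_prob k \<epsilon> \<tau> \<le> sqrt (real k) / (\<epsilon> * real \<tau>)"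
proof -
  define y where "y = sqrt (real k) / (\<epsilon> * real \<tau>)"
  have y: "y > 0" using assms by (simp add: y_def)
  have "real_of_int (min 0 \<lfloor>log 2 y\<rfloor>) \<le> log 2 y" by linarith
  then have "2 powr real_of_int (min 0 \<lfloor>log 2 y\<rfloor>) \<le> 2 powr log 2 y" by (intro powr_mono) auto
  also have "\<dots> = y" using y by simp
  finally show ?thesis by (simp only: new_prob_def y_def)
qed

text \<open>Rounding the binary logarithm down costs at most a factor 2.\<close>

lemma new_prob_ge: 
  assumes "\<epsilon> > 0" "k \<ge> 1" "\<tau> \<ge> 1"
  shows "new_prob k \<epsilon> \<tau> \<ge> min 1 (sqrt (real k) / (2 * \<epsilon> * real \<tau>))"
proof -
  define y where "y = sqrt (real k) / (\<epsilon> * real \<tau>)"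
  have y: "y > 0" using assms by (simp add: y_def)
  have "real_of_int (min 0 \<lfloor>log 2 y\<rfloor>) \<ge> min 0 (log 2 y - 1)" by linarith
  then have ge: "2 powr (min 0 (log 2 y - 1)) \<le> 2 powr real_of_int (min 0 \<lfloor>log 2 y\<rfloor>)"
    by (intro powr_mono) auto
   have "2 powr (log 2 y - 1) = y / 2" using y by (simp add: powr_diff)
  then have "min 1 (y / 2) \<le> 2 powr (min 0 (log 2 y - 1))" by (auto simp: min_def)
  also note ge
  also have "y / 2 = sqrt (real k) / (2 * \<epsilon> * real \<tau>)" by (simp add: y_def)
  finally show ?thesis by (simp only: new_prob_def y_def)
qed

lemma new_prob_le_1: "new_prob k \<epsilon> \<tau> \<le> 1"
  unfolding new_prob_def by (rule order_trans[OF powr_mono[of _ 0]]) auto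

lemma new_prob_pos: "new_prob k \<epsilon> \<tau> > 0"
  by (simp add: new_prob_def)

lemma new_prob_antimono:
  assumes "\<epsilon> > 0" "k \<ge> 1" "\<tau> \<ge> 1" "\<tau> \<le> \<tau>'"
  shows "new_prob k \<epsilon> \<tau>' \<le> new_prob k \<epsilon> \<tau>"
proof -
  have "sqrt (real k) / (\<epsilon> * real \<tau>') \<le> sqrt (real k) / (\<epsilon> * real \<tau>)"
    using assms by (intro divide_left_mono mult_left_mono mult_pos_pos) auto
  then have "log 2 (sqrt (real k) / (\<epsilon> * real \<tau>')) \<le> log 2 (sqrt (real k) / (\<epsilon> * real \<tau>))"
    using assms by (intro log_mono) auto
  then have "min 0 \<lfloor>log 2 (sqrt (real k) / (\<epsilon> * real \<tau>'))\<rfloor> \<le> min 0 \<lfloor>log 2 (sqrt (real k) / (\<epsilon> * real \<tau>))\<rfloor>"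
    by (intro min.mono floor_mono) auto
  then show ?thesis unfolding new_prob_def by (intro powr_mono) auto
qed

text \<open>In the branch with new probability 1 the hypotheses force the old one to be 1 as well,
  so untouched estimates agree with recomputed ones. Both branches then have a common
  description.\<close>

lemma boundary_support:
  assumes "s' \<in> set_pmf (boundary k \<epsilon> n' s)" "\<And>j. nhat s j = est (prob s) (nbar s j)"
    "new_prob k \<epsilon> n' \<le> prob s" "prob s \<le> 1"
  shows "\<exists>nb nh. s' = s\<lparr>prob := new_prob k \<epsilon> n', nbar := nb, nhat := nh\<rparr> \<and>
           (\<forall>j. nb j \<le> nbar s j \<and> nh j = est (new_prob k \<epsilon> n') (nb j))"
proof (cases "new_prob k \<epsilon> n' < 1")
  case True
  then obtain Z where "s' = (let nb = (\<lambda>i. nbar s i - Z i) in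
      s\<lparr>prob := new_prob k \<epsilon> n', nbar := nb,
        nhat := (\<lambda>i. if nb i = 0 then 0 else real (nb i) - 1 + 1 / new_prob k \<epsilon> n')\<rparr>)"
    using assms(1) by (auto simp: boundary_def Let_def)
  then show ?thesis
    by (intro exI[of _ "\<lambda>i. nbar s i - Z i"] exI[of _ "\<lambda>i. est (new_prob k \<epsilon> n') (nbar s i - Z i)"])
      (auto simp: est_def Let_def)
next
  case False
  then have "prob s = 1" "new_prob k \<epsilon> n' = 1" using assms by auto
  then show ?thesis using assms(1,2)
    by (intro exI[of _ "nbar s"] exI[of _ "nhat s"]) (auto simp: boundary_def Let_def)
qed

text \<open>Sites are resampled independently, so the exponential moment factors over
  \<open>V\<close> and \<open>nn_integral_Z_est\<close> bounds each factor. The offsets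
  \<open>w\<close> will be the count at the last report plus \<open>gain\<close>.\<close>

lemma nn_integral_boundary_exp_nhat:
  fixes \<theta> \<mu> :: real
  assumes nh: "\<And>j. nhat s j = est (prob s) (nbar s j)"
    and p: "new_prob k \<epsilon> n' \<le> prob s" "prob s \<le> 1"
    and th: "0 \<le> \<theta>" "\<theta> \<le> \<mu> * new_prob k \<epsilon> n'" and mu: "\<mu> \<le> 1 / 2" and V: "V \<subseteq> {..<k}"
  shows "(\<integral>\<^sup>+s'. ennreal (exp (- \<theta> * (\<Sum>j\<in>V. nhat s' j - w j))) \<partial>boundary k \<epsilon> n' s)
     \<le> ennreal ((1 + 2 * \<mu>\<^sup>2) ^ card V * exp (- \<theta> * (\<Sum>j\<in>V. nhat s j - w j)))"
proof -
  define p where "p = new_prob k \<epsilon> n'"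
  have p0: "p > 0" by (simp add: p_def new_prob_pos)
  have fV: "finite V" using V finite_subset by blast
  show ?thesis
  proof (cases "p < 1")
    case False
    then have "(\<integral>\<^sup>+s'. ennreal (exp (- \<theta> * (\<Sum>j\<in>V. nhat s' j - w j))) \<partial>boundary k \<epsilon> n' s) =
      ennreal (1 * exp (- \<theta> * (\<Sum>j\<in>V. nhat s j - w j)))"
      by (simp add: boundary_def p_def)
    also have "\<dots> \<le> ennreal ((1 + 2 * \<mu>\<^sup>2) ^ card V * exp (- \<theta> * (\<Sum>j\<in>V. nhat s j - w j)))"
      by (intro ennreal_leI mult_right_mono) auto
    finally show ?thesis .
  next
    case True
    define g where "g j z = (if j \<in> V then ennreal (exp (\<theta> * w j)) * ennreal (exp (- \<theta> * est p (nbar s j - z))) else 1)" for j z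
    have "(\<integral>\<^sup>+s'. ennreal (exp (- \<theta> * (\<Sum>j\<in>V. nhat s' j - w j))) \<partial>boundary k \<epsilon> n' s) =
      (\<integral>\<^sup>+Z. ennreal (exp (- \<theta> * (\<Sum>j\<in>V. est p (nbar s j - Z j) - w j)))
         \<partial>Pi_pmf {..<k} 0 (\<lambda>_. Z_pmf p (prob s)))"
      using True by (simp add: boundary_def Let_def flip: p_def est_def)
    also have "\<dots> = (\<integral>\<^sup>+Z. (\<Prod>j<k. g j (Z j)) \<partial>Pi_pmf {..<k} 0 (\<lambda>_. Z_pmf p (prob s)))"
    proof (rule nn_integral_cong)
      fix Z :: "nat \<Rightarrow> nat"
      have "(\<Prod>j<k. g j (Z j)) = (\<Prod>j\<in>V. ennreal (exp (\<theta> * w j)) * ennreal (exp (- \<theta> * est p (nbar s j - Z j))))"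
        using V by (intro prod.mono_neutral_cong_right) (auto simp: g_def)
      also have "\<dots> = (\<Prod>j\<in>V. ennreal (exp (- \<theta> * (est p (nbar s j - Z j) - w j))))"
        by (intro prod.cong refl) (simp add: algebra_simps flip: ennreal_mult exp_add)
      also have "\<dots> = ennreal (exp (- \<theta> * (\<Sum>j\<in>V. est p (nbar s j - Z j) - w j)))"
        using fV by (simp add: prod_ennreal exp_sum sum_distrib_left)
      finally show "ennreal (exp (- \<theta> * (\<Sum>j\<in>V. est p (nbar s j - Z j) - w j))) = (\<Prod>j<k. g j (Z j))" ..
    qed
    also have "\<dots> = (\<Prod>j<k. \<integral>\<^sup>+z. g j z \<partial>Z_pmf p (prob s))"
      by (intro nn_integral_prod_Pi_pmf) auto
    also have "\<dots> = (\<Prod>j\<in>V. \<integral>\<^sup>+z. g j z \<partial>Z_pmf p (prob s))"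
      using V by (intro prod.mono_neutral_cong_right) (auto simp: g_def)
    also have "\<dots> \<le> (\<Prod>j\<in>V. ennreal ((1 + 2 * \<mu>\<^sup>2) * exp (- \<theta> * (nhat s j - w j))))"
    proof (rule prod_mono_ennreal)
      fix j assume j: "j \<in> V"
      have "(\<integral>\<^sup>+z. g j z \<partial>Z_pmf p (prob s)) = ennreal (exp (\<theta> * w j)) *
          (\<integral>\<^sup>+z. ennreal (exp (- \<theta> * est p (nbar s j - z))) \<partial>Z_pmf p (prob s))"
        using j by (simp add: g_def nn_integral_cmult)
      also have "\<dots> \<le> ennreal (exp (\<theta> * w j)) * ennreal ((1 + 2 * \<mu>\<^sup>2) * exp (- \<theta> * est (prob s) (nbar s j)))"
        using p th mu p0 True by (intro mult_left_mono nn_integral_Z_est) (auto simp: p_def)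
      also have "\<dots> = ennreal ((1 + 2 * \<mu>\<^sup>2) * exp (- \<theta> * (nhat s j - w j)))"
        by (simp add: nh algebra_simps flip: ennreal_mult exp_add)
      finally show "(\<integral>\<^sup>+z. g j z \<partial>Z_pmf p (prob s)) \<le> ennreal ((1 + 2 * \<mu>\<^sup>2) * exp (- \<theta> * (nhat s j - w j)))" .
    qed
    also have "\<dots> = ennreal ((1 + 2 * \<mu>\<^sup>2) ^ card V * exp (- \<theta> * (\<Sum>j\<in>V. nhat s j - w j)))"
      using fV by (simp add: prod_ennreal prod.distrib exp_sum sum_distrib_left)
    finally show ?thesis .
  qed
qed

subsection \<open>The round robin adversary\<close>

text \<open>Runs from the newest value back, because histories grow at the end. The appended 0 is
  the published value before the first event.\<close>

primrec nchanges_rev :: "real list \<Rightarrow> nat" where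
  "nchanges_rev [] = 0"
| "nchanges_rev (x # xs) = nchanges_rev xs + of_bool (x \<noteq> hd (xs @ [0]))"

definition nchanges :: "real list \<Rightarrow> nat" where
  "nchanges h = nchanges_rev (rev h)"

lemma nchanges_snoc: "nchanges (h @ [x]) = nchanges h + of_bool (x \<noteq> last (0 # h))"
  by (simp add: nchanges_def hd_append hd_rev last_ConsR)

lemma nchanges_take_le: "nchanges (take j h) \<le> nchanges h"
proof (induction h rule: rev_induct)
  case (snoc x h)
  then show ?case by (cases "j \<le> length h") (auto simp: nchanges_snoc)
qed simp

text \<open>The relation the doubling subprotocol maintains between the count \<open>c\<close> of a
  site and the last value \<open>d\<close> the server received from it.\<close>

definition log_floor :: "nat \<Rightarrow> nat \<Rightarrow> bool" where
  "log_floor c d \<longleftrightarrow> c = 0 \<and> d = 0 \<or> (\<exists>a. d = 2 ^ a \<and> 2 ^ a \<le> c \<and> c < 2 ^ Suc a)"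

lemma log_floor_le: "log_floor c d \<Longrightarrow> d \<le> c"
  by (auto simp: log_floor_def)

lemma log_floor_less: "log_floor c d \<Longrightarrow> c \<le> 2 * d"
  by (auto simp: log_floor_def)

lemma log_floor_Suc:
  assumes "log_floor c d"
  shows "log_floor (Suc c) (if \<exists>a. Suc c = 2 ^ a then Suc c else d)"
proof (cases "\<exists>a. Suc c = 2 ^ a")
  case True
  then show ?thesis by (auto simp: log_floor_def)
next
  case False
  then have "c \<noteq> 0" by (metis One_nat_def power_0)
  then obtain a where a: "d = 2 ^ a" "2 ^ a \<le> c" "c < 2 ^ Suc a" using assms by (auto simp: log_floor_def)
  moreover have "Suc c \<noteq> 2 ^ Suc a" using False by blast
  ultimately have "Suc c < 2 ^ Suc a" by linarith
  then show ?thesis using a False by (auto simp: log_floor_def intro!: exI[of _ a])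
qed

text \<open>\<open>m\<close> is the number of sites that may receive events. It will be 1 for
  bounded \<open>k\<close> and about \<open>k / 16\<close> otherwise.\<close>

locale round_robin =
  fixes k m :: nat and \<epsilon> :: real
  assumes m: "1 \<le> m" "m \<le> k" and eps: "0 < \<epsilon>" "\<epsilon> \<le> 1 / sqrt (real k)"
begin

lemma k_pos: "1 \<le> k" using m by simp

text \<open>Counting changes of the published value modulo \<open>m\<close> encodes the current site
  as a function of the history alone.\<close>

definition adv :: "real list \<Rightarrow> nat" where
  "adv h = nchanges h mod m"

lemma adv_less: "adv h < m"
  using m by (simp add: adv_def)

definition arrive :: "bool \<Rightarrow> nat \<Rightarrow> hyz_state \<Rightarrow> hyz_state" where
  "arrive b i s = (let s1 = s\<lparr>cnt := (cnt s)(i := cnt s i + 1)\<rparr> in if b then report k i s1 else s1)"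

text \<open>The third component is a ghost variable: the count of each site at the time of its last report,
  which neither the state nor the published history determines.\<close>

type_synonym config = "hyz_state \<times> real list \<times> (nat \<Rightarrow> nat)"

definition arrive' :: "bool \<Rightarrow> config \<Rightarrow> config" where
  "arrive' b = (\<lambda>(s, h, r). (arrive b (adv h) s, h @ [pub (arrive b (adv h) s)],
     if b then r(adv h := cnt s (adv h) + 1) else r))"

definition doubling' :: "nat \<Rightarrow> config \<Rightarrow> config pmf" where
  "doubling' i = (\<lambda>(s, h, r). map_pmf (\<lambda>s'. (s', h, r)) (doubling k \<epsilon> i s))"

definition step' :: "config \<Rightarrow> config pmf" where
  "step' x = bernoulli_pmf (prob (fst x)) \<bind> (\<lambda>b. doubling' (adv (fst (snd x))) (arrive' b x))"

primrec run' :: "nat \<Rightarrow> config pmf" where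
  "run' 0 = return_pmf (hyz_init, [], \<lambda>_. 0)"
| "run' (Suc t) = run' t \<bind> step'"

section \<open>The run with the ghost variable: projection and invariants\<close>

lemma pub_boundary: "s' \<in> set_pmf (boundary k \<epsilon> n' s) \<Longrightarrow> pub s' = pub s"
  by (auto simp: boundary_def Let_def split: if_splits)

lemma pub_doubling: "s' \<in> set_pmf (doubling k \<epsilon> i s) \<Longrightarrow> pub s' = pub s"
  by (auto simp: doubling_def Let_def split: if_splits dest!: pub_boundary)

text \<open>The ghost run extends the history before the doubling step, the protocol after it. Both
  record the same value because \<open>doubling\<close> never changes \<open>pub\<close>.\<close>

lemma run'_project: "map_pmf (\<lambda>(s, h, r). (s, h)) (run' t) = hyz_run k \<epsilon> adv t"
proof (induction t)
  case (Suc t)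
  have step: "map_pmf (\<lambda>(s, h, r). (s, h)) (step' (s, h, r)) =
      map_pmf (\<lambda>s'. (s', h @ [pub s'])) (hyz_step k \<epsilon> (adv h) s)" for s h r
  proof -
    have "map_pmf (\<lambda>(s, h, r). (s, h)) (doubling' (adv h) (arrive' b (s, h, r))) =
        map_pmf (\<lambda>s'. (s', h @ [pub s'])) (doubling k \<epsilon> (adv h) (arrive b (adv h) s))" for b
      by (auto simp: doubling'_def arrive'_def pmf.map_comp o_def dest: pub_doubling intro!: map_pmf_cong)
    then show ?thesis
      by (simp add: step'_def hyz_step_def map_bind_pmf arrive_def Let_def)
  qed
  have "map_pmf (\<lambda>(s, h, r). (s, h)) (run' (Suc t)) =
      run' t \<bind> (\<lambda>(s, h, r). map_pmf (\<lambda>s'. (s', h @ [pub s'])) (hyz_step k \<epsilon> (adv h) s))"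
    by (auto simp: map_bind_pmf step intro!: bind_pmf_cong)
  also have "\<dots> = map_pmf (\<lambda>(s, h, r). (s, h)) (run' t) \<bind>
      (\<lambda>(s, h). map_pmf (\<lambda>s'. (s', h @ [pub s'])) (hyz_step k \<epsilon> (adv h) s))"
    by (simp add: bind_map_pmf split_beta')
  finally show ?case by (simp add: Suc.IH)
qed simp

text \<open>The part of the invariant that holds before and after the doubling step alike. Its key
  clause is that only the site played next can have events after its last report, since the
  adversary leaves a site only when a report changes the published value.\<close>

definition core :: "nat \<Rightarrow> config \<Rightarrow> bool" where
  "core t = (\<lambda>(s, h, r). length h = t \<and> pub s = last (0 # h) \<and>
     (\<forall>j. nbar s j \<le> r j \<and> r j \<le> cnt s j \<and> (j \<noteq> adv h \<longrightarrow> r j = cnt s j) \<and>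
          nhat s j = est (prob s) (nbar s j) \<and> (m \<le> j \<longrightarrow> cnt s j = 0)) \<and>
     (\<Sum>j<m. cnt s j) = t \<and> (\<Sum>j<m. dlast s j) = dsum s \<and>
     prob s = new_prob k \<epsilon> (tau s) \<and> 1 \<le> tau s \<and> dsum s < 2 * tau s \<and> tau s \<le> max 1 (dsum s))"

definition run_inv :: "nat \<Rightarrow> config \<Rightarrow> bool" where
  "run_inv t x \<longleftrightarrow> core t x \<and> (\<forall>j. log_floor (cnt (fst x) j) (dlast (fst x) j))"

text \<open>After an arrival \<open>dlast\<close> still matches the old count of site
  \<open>i\<close>, hence the \<open>- 1\<close>.\<close>

definition mid_inv :: "nat \<Rightarrow> nat \<Rightarrow> config \<Rightarrow> bool" where
  "mid_inv t i x \<longleftrightarrow> core t x \<and> i < m \<and> cnt (fst x) i \<ge> 1 \<and>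
     (\<forall>j. log_floor (if j = i then cnt (fst x) i - 1 else cnt (fst x) j) (dlast (fst x) j))"

text \<open>The initial probability 1 must agree with \<open>new_prob\<close> at
  \<open>tau = 1\<close>. This holds because \<open>\<epsilon> \<le> 1 / sqrt k\<close> makes
  \<open>sqrt k / \<epsilon>\<close> at least 1.\<close>

lemma inv_init: "run_inv 0 (hyz_init, [], \<lambda>_. 0)"
proof -
  have "sqrt (real k) / \<epsilon> \<ge> 1"
  proof -
    have k1: "1 \<le> sqrt (real k)" using k_pos by simp
    have "1 / sqrt (real k) \<le> 1" using k1 by simp
    then have "\<epsilon> \<le> sqrt (real k)" using eps k1 by linarith
    then show ?thesis using eps by simp
  qed
  then have "0 \<le> log 2 (sqrt (real k) / \<epsilon>)" by simp
  then have "new_prob k \<epsilon> 1 = 1" by (simp add: new_prob_def)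
  then show ?thesis by (auto simp: run_inv_def core_def hyz_init_def est_def log_floor_def)
qed

text \<open>The value received last from a site is at least half its count, and \<open>dsum\<close>
  is below \<open>2 * tau\<close>; the two factors 2 give \<open>4 * tau\<close>. Conversely,
  received values never exceed the counts.\<close>

lemma inv_tau:
  assumes "run_inv t (s, h, r)"
  shows "t < 4 * tau s" "tau s \<le> max 1 t" 
proof -
  have "t = (\<Sum>j<m. cnt s j)" using assms by (auto simp: run_inv_def core_def)
  also have "\<dots> \<le> (\<Sum>j<m. 2 * dlast s j)"
    using assms by (intro sum_mono log_floor_less) (auto simp: run_inv_def)
  also have "\<dots> = 2 * dsum s" using assms by (simp add: run_inv_def core_def flip: sum_distrib_left)
  also have "\<dots> < 4 * tau s" using assms by (simp add: run_inv_def core_def)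
  finally show "t < 4 * tau s" .
  have "dsum s = (\<Sum>j<m. dlast s j)" using assms by (simp add: run_inv_def core_def)
  also have "\<dots> \<le> (\<Sum>j<m. cnt s j)"
    using assms by (intro sum_mono log_floor_le) (auto simp: run_inv_def)
  also have "\<dots> = t" using assms by (simp add: run_inv_def core_def)
  finally show "tau s \<le> max 1 t" using assms by (auto simp: run_inv_def core_def)
qed

lemma sum_upd_Suc:
  fixes f :: "nat \<Rightarrow> nat"
  assumes "i < m"
  shows "(\<Sum>j<m. if j = i then Suc (f i) else f j) = Suc (\<Sum>j<m. f j)"
proof -
  have "(\<Sum>j<m. if j = i then Suc (f i) else f j) = (\<Sum>j<m. f j + (if j = i then 1 else 0))"
    by (intro sum.cong) auto
  then show ?thesis using assms by (simp add: sum.distrib)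
qed

text \<open>Without a report the published value is unchanged and the adversary stays put; with a
  report the ghost count catches up with the count, so the site may be left.\<close>

lemma mid_inv_arrive':
  assumes "run_inv t (s, h, r)"
  shows "mid_inv (Suc t) (adv h) (arrive' b (s, h, r))"
proof -
  have i: "adv h < m" by (rule adv_less)
  have *: "log_floor (cnt s j) (dlast s j)" for j using assms by (auto simp: run_inv_def)
  have r: "r j \<le> cnt s j" "nbar s j \<le> r j" "j \<noteq> adv h \<Longrightarrow> r j = cnt s j" for j
    using assms by (auto simp: run_inv_def core_def)
  have nb: "nbar s j \<le> cnt s j" for j using r[of j] by simp
  show ?thesis
  proof (cases b)
    case False
    then have "adv (h @ [pub s]) = adv h" using assms
      by (simp add: adv_def nchanges_snoc run_inv_def core_def)
    then show ?thesis using False assms i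
      by (auto simp: mid_inv_def arrive'_def arrive_def run_inv_def core_def sum_upd_Suc le_Suc_eq)
  next
    case True
    then show ?thesis using assms i
      by (auto simp: mid_inv_def arrive'_def arrive_def run_inv_def core_def sum_upd_Suc report_def
          Let_def le_Suc_eq est_def nb)
  qed
qed

text \<open>The case \<open>stay\<close> covers both a silent site and a value that triggers no
  boundary: the potentials used later see neither \<open>dsum\<close> nor
  \<open>dlast\<close>.\<close>

lemma doubling'_cases:
  assumes "mid_inv t i (s, h, r)"
  obtains (stay) d D where "doubling' i (s, h, r) = return_pmf (s\<lparr>dsum := D, dlast := d\<rparr>, h, r)"
      "run_inv t (s\<lparr>dsum := D, dlast := d\<rparr>, h, r)"
  | (boundary) d D where "2 * tau s \<le> D" "D \<le> t"
      "doubling' i (s, h, r) =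
         map_pmf (\<lambda>s'. (s'\<lparr>tau := D\<rparr>, h, r)) (boundary k \<epsilon> D (s\<lparr>dsum := D, dlast := d\<rparr>))"
      "new_prob k \<epsilon> D \<le> prob s" "prob s \<le> 1"
      "\<And>s'. s' \<in> set_pmf (boundary k \<epsilon> D (s\<lparr>dsum := D, dlast := d\<rparr>)) \<Longrightarrow> run_inv t (s'\<lparr>tau := D\<rparr>, h, r)"
proof -
  define pw where "pw \<longleftrightarrow> (\<exists>a. cnt s i = 2 ^ a)"
  define d where "d = (if pw then (dlast s)(i := cnt s i) else dlast s)"
  define D where "D = (if pw then dsum s + cnt s i - dlast s i else dsum s)"
  have i: "i < m" and ci: "cnt s i \<ge> 1" and core: "core t (s, h, r)"
    using assms by (auto simp: mid_inv_def)
  have lfi: "log_floor (cnt s i - 1) (dlast s i)" and lfj: "\<And>j. j \<noteq> i \<Longrightarrow> log_floor (cnt s j) (dlast s j)"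
    using assms by (auto simp: mid_inv_def split: if_splits)
  have lf: "log_floor (cnt s j) (d j)" for j
    using log_floor_Suc[OF lfi] ci lfj[of j] by (auto simp: d_def pw_def split: if_splits)
  have dle: "dlast s i \<le> dsum s"
  proof -
    have "dlast s i \<le> (\<Sum>j<m. dlast s j)" using i by (intro member_le_sum) auto
    then show ?thesis using core by (simp add: core_def)
  qed
  have dD: "(\<Sum>j<m. d j) = D"
  proof -
    have "(\<Sum>j<m. ((dlast s)(i := cnt s i)) j) + dlast s i = (\<Sum>j<m. dlast s j) + cnt s i"
      using i by (simp add: sum.remove[of "{..<m}" i])
    moreover have "(\<Sum>j<m. dlast s j) = dsum s" using core by (simp add: core_def)
    ultimately show ?thesis using dle by (cases pw) (auto simp: d_def D_def)
  qed
  have Dt: "D \<le> t"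
  proof -
    have "(\<Sum>j<m. d j) \<le> (\<Sum>j<m. cnt s j)" by (intro sum_mono log_floor_le lf)
    then show ?thesis using core dD by (simp add: core_def)
  qed
  have Ddsum: "D \<ge> dsum s" using lfi ci log_floor_le[OF lfi] by (auto simp: D_def)
  show ?thesis
  proof (cases "2 * tau s \<le> D")
    case False
    have eq: "doubling k \<epsilon> i s = return_pmf (s\<lparr>dsum := D, dlast := d\<rparr>)"
      using False by (auto simp: doubling_def pw_def[symmetric] D_def d_def Let_def)
    have "run_inv t (s\<lparr>dsum := D, dlast := d\<rparr>, h, r)"
      using core lf dD False Ddsum by (auto simp: run_inv_def core_def)
    with eq show ?thesis by (intro stay[of d D]) (auto simp: doubling'_def)
  next
    case True
    have pw: "pw" using True core by (auto simp: D_def core_def split: if_splits)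
    have eq: "doubling k \<epsilon> i s = map_pmf (\<lambda>s'. s'\<lparr>tau := D\<rparr>) (boundary k \<epsilon> D (s\<lparr>dsum := D, dlast := d\<rparr>))"
      using True pw by (auto simp: doubling_def pw_def[symmetric] D_def d_def Let_def)
    have tau: "1 \<le> tau s" "prob s = new_prob k \<epsilon> (tau s)" using core by (auto simp: core_def)
    have pp: "new_prob k \<epsilon> D \<le> prob s" "prob s \<le> 1"
      using tau True eps k_pos by (auto simp: new_prob_le_1 intro: new_prob_antimono)
    show ?thesis
    proof (rule boundary[of D d, OF True Dt _ pp])
      show "doubling' i (s, h, r) =
         map_pmf (\<lambda>s'. (s'\<lparr>tau := D\<rparr>, h, r)) (Defs.boundary k \<epsilon> D (s\<lparr>dsum := D, dlast := d\<rparr>))"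
        by (simp add: doubling'_def eq pmf.map_comp o_def)
    next
      fix s' assume "s' \<in> set_pmf (Defs.boundary k \<epsilon> D (s\<lparr>dsum := D, dlast := d\<rparr>))"
      then obtain nb nh where s': "s' = s\<lparr>dsum := D, dlast := d, prob := new_prob k \<epsilon> D, nbar := nb, nhat := nh\<rparr>"
        and nb: "\<And>j. nb j \<le> nbar s j" "\<And>j. nh j = est (new_prob k \<epsilon> D) (nb j)"
        using boundary_support[of s' k \<epsilon> D "s\<lparr>dsum := D, dlast := d\<rparr>"] pp core
        by (auto simp: core_def)
      have "nb j \<le> r j" for j using nb(1)[of j] core by (auto simp: core_def intro: order_trans)
      then show "run_inv t (s'\<lparr>tau := D\<rparr>, h, r)"
        using core lf dD True tau nb by (auto simp: run_inv_def core_def s')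
    qed
  qed
qed

lemma inv_step':
  assumes "run_inv t x" "y \<in> set_pmf (step' x)"
  shows "run_inv (Suc t) y"
proof -
  obtain s h r where x: "x = (s, h, r)" by (cases x)
  obtain b where "y \<in> set_pmf (doubling' (adv h) (arrive' b x))"
    using assms(2) by (auto simp: step'_def x)
  moreover have "mid_inv (Suc t) (adv h) (arrive' b x)" using assms mid_inv_arrive' x by simp
  moreover obtain s1 h1 r1 where "arrive' b x = (s1, h1, r1)" by (cases "arrive' b x")
  ultimately show ?thesis
    by (auto elim!: doubling'_cases[of "Suc t" "adv h" s1 h1 r1])
qed

lemma inv_run': "x \<in> set_pmf (run' t) \<Longrightarrow> run_inv t x"
  by (induction t arbitrary: x) (auto simp: inv_init intro: inv_step')

end

subsection \<open>Supermartingales on the last half of the stream\<close>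

lemma pmf_Markov:
  assumes "\<And>x. x \<in> set_pmf M \<Longrightarrow> x \<in> A \<Longrightarrow> ennreal c \<le> \<Phi> x" "c > 0"
    "(\<integral>\<^sup>+x. \<Phi> x \<partial>measure_pmf M) \<le> ennreal B" "B \<ge> 0"
  shows "measure_pmf.prob M A \<le> B / c"
proof -
  have "ennreal c * emeasure (measure_pmf M) A = (\<integral>\<^sup>+x. ennreal c * indicator A x \<partial>measure_pmf M)"
    by (simp add: nn_integral_cmult_indicator)
  also have "\<dots> \<le> (\<integral>\<^sup>+x. \<Phi> x \<partial>measure_pmf M)"
    using assms(1) by (intro nn_integral_mono_AE AE_pmfI) (auto simp: indicator_def)
  also note assms(3)
  finally have "c * measure_pmf.prob M A \<le> B"
    using assms(2,4) by (simp add: measure_pmf.emeasure_eq_measure flip: ennreal_mult)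
  then show ?thesis using assms(2) by (simp add: field_simps)
qed

context round_robin
begin

text \<open>The initial bound \<open>B\<close> is uniform over all states satisfying the invariant
  at time \<open>a\<close>, so any behaviour before the window is covered.\<close>

lemma nn_integral_run'_le:
  assumes "\<And>t x. a \<le> t \<Longrightarrow> t < b \<Longrightarrow> run_inv t x \<Longrightarrow> (\<integral>\<^sup>+y. \<Phi> y \<partial>step' x) \<le> ennreal c * \<Phi> x"
    and "\<And>x. run_inv a x \<Longrightarrow> \<Phi> x \<le> ennreal B" and "c \<ge> 0" "B \<ge> 0" "a + j \<le> b"
  shows "(\<integral>\<^sup>+x. \<Phi> x \<partial>run' (a + j)) \<le> ennreal (c ^ j * B)"
  using assms(5)
proof (induction j)
  case 0
  have "(\<integral>\<^sup>+x. \<Phi> x \<partial>run' a) \<le> (\<integral>\<^sup>+x. ennreal B \<partial>run' a)"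
    using assms(2) by (intro nn_integral_mono_AE AE_pmfI) (auto dest: inv_run')
  then show ?case by simp
next
  case (Suc j)
  have "(\<integral>\<^sup>+x. \<Phi> x \<partial>run' (a + Suc j)) = (\<integral>\<^sup>+x. \<integral>\<^sup>+y. \<Phi> y \<partial>step' x \<partial>run' (a + j))" by simp
  also have "\<dots> \<le> (\<integral>\<^sup>+x. ennreal c * \<Phi> x \<partial>run' (a + j))"
    using Suc.prems by (intro nn_integral_mono_AE AE_pmfI assms(1)[of "a + j"]) (auto dest: inv_run')
  also have "\<dots> = ennreal c * (\<integral>\<^sup>+x. \<Phi> x \<partial>run' (a + j))" by (simp add: nn_integral_cmult)
  also have "\<dots> \<le> ennreal c * ennreal (c ^ j * B)"
    using Suc by (intro mult_left_mono) auto
  also have "\<dots> = ennreal (c ^ Suc j * B)"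
    using assms(3,4) by (simp add: mult_ac flip: ennreal_mult)
  finally show ?case .
qed

lemma nn_integral_step'_le:
  assumes "run_inv t (s, h, r)"
    and "\<And>y. mid_inv (Suc t) (adv h) y \<Longrightarrow> (\<integral>\<^sup>+z. \<Phi> z \<partial>doubling' (adv h) y) \<le> \<Phi> y"
  shows "(\<integral>\<^sup>+y. \<Phi> y \<partial>step' (s, h, r)) \<le>
    \<Phi> (arrive' True (s, h, r)) * ennreal (prob s) + \<Phi> (arrive' False (s, h, r)) * ennreal (1 - prob s)"
proof -
  have "0 \<le> prob s" "prob s \<le> 1" using assms(1) new_prob_pos[of k \<epsilon> "tau s"] new_prob_le_1[of k \<epsilon> "tau s"]
    by (auto simp: run_inv_def core_def)
  then have "(\<integral>\<^sup>+y. \<Phi> y \<partial>step' (s, h, r)) =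
      (\<integral>\<^sup>+z. \<Phi> z \<partial>doubling' (adv h) (arrive' True (s, h, r))) * ennreal (prob s) +
      (\<integral>\<^sup>+z. \<Phi> z \<partial>doubling' (adv h) (arrive' False (s, h, r))) * ennreal (1 - prob s)"
    by (simp add: step'_def)
  also have "\<dots> \<le> \<Phi> (arrive' True (s, h, r)) * ennreal (prob s) + \<Phi> (arrive' False (s, h, r)) * ennreal (1 - prob s)"
    by (intro add_mono mult_right_mono assms(2) mid_inv_arrive'[OF assms(1)]) auto
  finally show ?thesis .
qed

text \<open>Can fail only between a boundary, which alters \<open>nhat\<close> without publishing,
  and the next report.\<close>

definition synced :: "hyz_state \<Rightarrow> bool" where
  "synced s \<longleftrightarrow> pub s = (\<Sum>j<k. nhat s j)"

lemma sum_nhat: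
  assumes "core t (s, h, r)"
  shows "(\<Sum>j<k. nhat s j) = (\<Sum>j<m. nhat s j)"
proof (rule sum.mono_neutral_right)
  show "\<forall>j\<in>{..<k} - {..<m}. nhat s j = 0"
  proof
    fix j assume "j \<in> {..<k} - {..<m}"
    then have "cnt s j = 0" "nbar s j \<le> r j" "r j \<le> cnt s j" "nhat s j = est (prob s) (nbar s j)"
      using assms by (auto simp: core_def)
    then show "nhat s j = 0" by (simp add: est_def)
  qed
qed (use m in auto)

lemma nchanges_arrive'_False:
  assumes "run_inv t (s, h, r)"
  shows "nchanges (h @ [pub s]) = nchanges h"
  using assms by (simp add: nchanges_snoc run_inv_def core_def)

text \<open>The new estimate of the reporting site strictly exceeds the old one, because the
  recorded count was at most the old count. A current published value therefore rises.\<close>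

lemma nchanges_arrive'_True:
  assumes "run_inv t (s, h, r)" "s1 = arrive True (adv h) s"
  shows "nchanges (h @ [pub s1]) = nchanges h + of_bool (pub s1 \<noteq> pub s)"
    "synced s1" "synced s \<Longrightarrow> pub s1 \<noteq> pub s"
proof -
  have core: "core t (s, h, r)" using assms(1) by (simp add: run_inv_def)
  then show "nchanges (h @ [pub s1]) = nchanges h + of_bool (pub s1 \<noteq> pub s)"
    by (simp add: nchanges_snoc core_def)
  show sy: "synced s1"
    by (auto simp: assms(2) arrive_def Let_def report_def synced_def intro!: sum.cong)
  assume "synced s"
  have p0: "prob s > 0" using core new_prob_pos[of k \<epsilon> "tau s"] by (simp add: core_def)
  define i where "i = adv h"
  have i: "i < k" using adv_less[of h] m by (simp add: i_def)
  have nh: "nhat s i = est (prob s) (nbar s i)" "nbar s i \<le> cnt s i"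
    using core by (auto simp: core_def intro: order_trans)
  have gt: "nhat s i < real (cnt s i + 1) - 1 + 1 / prob s"
    using nh p0 by (auto simp: est_def intro: add_nonneg_pos)
  have "pub s = (\<Sum>j<k. nhat s j)" using \<open>synced s\<close> by (simp add: synced_def)
  also have "\<dots> < (\<Sum>j<k. nhat s1 j)"
    using gt i by (intro sum_strict_mono_ex1)
      (auto simp: assms(2) arrive_def Let_def report_def i_def[symmetric] intro!: bexI[of _ i])
  also have "\<dots> = pub s1" using sy by (simp add: synced_def)
  finally show "pub s1 \<noteq> pub s" by simp
qed

end

section \<open>The window of the last \<open>n / 2\<close> events\<close>

locale window = round_robin +
  fixes n :: nat
  assumes n_large: "real n > 64 * sqrt (real k) / \<epsilon>"
begin

definition ws :: nat where "ws = n div 2"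

text \<open>In the window \<open>tau\<close> lies between \<open>n / 8\<close> and \<open>n\<close>.
  Together with the factor 2 lost by rounding, this confines \<open>prob\<close> to the interval
  from \<open>pmin\<close> to \<open>pmax\<close>, and \<open>gain\<close> bounds from below the
  overestimate \<open>1 / p - 1\<close> just after a report.\<close>

definition pmin :: real where "pmin = sqrt (real k) / (2 * \<epsilon> * real n)"

definition pmax :: real where "pmax = 8 * sqrt (real k) / (\<epsilon> * real n)"

definition gain :: real where "gain = 1 / pmax - 1"

definition visits :: "real list \<Rightarrow> nat" where
  "visits h = nchanges h - nchanges (take ws h)"

text \<open>The sites the adversary has left since time \<open>ws\<close>: counting from 0, change
  number \<open>j\<close> of the published value is caused by a report of site
  \<open>j mod m\<close>.\<close>

definition visited :: "real list \<Rightarrow> nat set" where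
  "visited h = (\<lambda>j. j mod m) ` {nchanges (take ws h)..<nchanges h}"

lemma n_pos: "real n > 0" "n > 0"
proof -
  show "real n > 0" using n_large eps k_pos by (smt (verit) divide_nonneg_pos real_sqrt_ge_zero of_nat_0_le_iff)
  then show "n > 0" by simp
qed

lemma pmin: "0 < pmin" "pmin \<le> 1"
proof -
  show "0 < pmin" using eps k_pos n_pos by (simp add: pmin_def)
  have "64 * sqrt (real k) < real n * \<epsilon>" using n_large eps by (simp add: field_simps)
  moreover have "0 \<le> sqrt (real k)" by simp
  ultimately have "sqrt (real k) \<le> 2 * (real n * \<epsilon>)" by linarith
  then show "pmin \<le> 1" using eps n_pos by (simp add: pmin_def mult_ac)
qed

lemma pmax: "0 < pmax" "pmax \<le> 1 / 8" "pmax = 16 * pmin"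
proof -
  show "0 < pmax" using eps k_pos n_pos by (simp add: pmax_def)
  show "pmax = 16 * pmin" by (simp add: pmax_def pmin_def)
  have "64 * sqrt (real k) < real n * \<epsilon>" using n_large eps by (simp add: field_simps)
  then show "pmax \<le> 1 / 8" using eps n_pos by (simp add: pmax_def divide_simps) (simp add: mult_ac)
qed

lemma pmin_le_new_prob:
  assumes "1 \<le> D" "D \<le> n"
  shows "pmin \<le> new_prob k \<epsilon> D"
proof -
  have "pmin \<le> sqrt (real k) / (2 * \<epsilon> * real D)"
    unfolding pmin_def using assms eps n_pos by (intro divide_left_mono mult_left_mono mult_pos_pos) auto
  then have "pmin \<le> min 1 (sqrt (real k) / (2 * \<epsilon> * real D))" using pmin by simp
  also have "\<dots> \<le> new_prob k \<epsilon> D" using assms eps k_pos by (intro new_prob_ge) auto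
  finally show ?thesis .
qed

lemma tau_window:
  assumes "run_inv t (s, h, r)" "ws \<le> t" "t \<le> n"
  shows "n \<le> 8 * tau s" "tau s \<le> n"
  using inv_tau[OF assms(1)] assms n_pos by (auto simp: ws_def)

lemma prob_window:
  assumes "run_inv t (s, h, r)" "ws \<le> t" "t \<le> n"
  shows "pmin \<le> prob s" "prob s \<le> pmax"
proof -
  have p: "prob s = new_prob k \<epsilon> (tau s)" "1 \<le> tau s" using assms by (auto simp: run_inv_def core_def)
  note tau = tau_window[OF assms]
  show "pmin \<le> prob s" using p tau pmin_le_new_prob by simp
  have "prob s \<le> sqrt (real k) / (\<epsilon> * real (tau s))" using p eps k_pos new_prob_le by simp
  also have "\<dots> \<le> sqrt (real k) / (\<epsilon> * (real n / 8))"
    using tau eps n_pos p by (intro divide_left_mono mult_left_mono mult_pos_pos) auto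
  also have "\<dots> = pmax" by (simp add: pmax_def)
  finally show "prob s \<le> pmax" .
qed

text \<open>Right after a report at event \<open>t\<close> the ghost counts sum to \<open>t\<close>,
  so a sum of at most \<open>n - u\<close> means that the last \<open>u\<close> events saw no
  report. Each of them is reported with probability at least \<open>pmin\<close>.\<close>

lemma prob_no_recent_report:
  assumes "u \<le> n - ws"
  shows "measure_pmf.prob (run' n) {(s, h, r). (\<Sum>j<m. r j) \<le> n - u} \<le> (1 - pmin) ^ u"
proof -
  define \<Phi> :: "config \<Rightarrow> ennreal" where "\<Phi> = (\<lambda>(s, h, r). of_bool ((\<Sum>j<m. r j) \<le> n - u))"
  have st: "(\<integral>\<^sup>+y. \<Phi> y \<partial>step' x) \<le> ennreal (1 - pmin) * \<Phi> x"
    if t: "n - u \<le> t" "t < n" and x: "run_inv t x" for t x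
  proof -
    obtain s h r where xx: "x = (s, h, r)" by (cases x)
    have inv: "run_inv t (s, h, r)" using x xx by simp
    have pr: "pmin \<le> prob s" using prob_window[OF inv] t assms by (simp add: ws_def)
    have dbl: "(\<integral>\<^sup>+z. \<Phi> z \<partial>doubling' i y) = \<Phi> y" for i y
      by (cases y) (simp add: doubling'_def \<Phi>_def)
    have False: "\<Phi> (arrive' False (s, h, r)) = \<Phi> x" by (simp add: \<Phi>_def arrive'_def xx)
    have "(\<Sum>j<m. (r(adv h := cnt s (adv h) + 1)) j) = (\<Sum>j<m. if j = adv h then Suc (cnt s (adv h)) else cnt s j)"
      using inv by (intro sum.cong) (auto simp: run_inv_def core_def)
    also have "\<dots> = Suc t" using inv adv_less by (subst sum_upd_Suc) (auto simp: run_inv_def core_def)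
    finally have True: "\<Phi> (arrive' True (s, h, r)) = 0"
      using t by (simp add: \<Phi>_def arrive'_def)
    have "(\<integral>\<^sup>+y. \<Phi> y \<partial>step' (s, h, r)) \<le> \<Phi> x * ennreal (1 - prob s)"
      using nn_integral_step'_le[OF inv, of \<Phi>] dbl by (simp add: True False)
    also have "\<dots> \<le> \<Phi> x * ennreal (1 - pmin)" using pr by (intro mult_left_mono ennreal_leI) auto
    finally show ?thesis by (simp add: xx mult_ac)
  qed
  have "(\<integral>\<^sup>+x. \<Phi> x \<partial>run' (n - u + u)) \<le> ennreal ((1 - pmin) ^ u * 1)"
    using pmin st assms by (intro nn_integral_run'_le[of "n - u" n]) (auto simp: \<Phi>_def split: prod.splits)
  then have "(\<integral>\<^sup>+x. \<Phi> x \<partial>run' n) \<le> ennreal ((1 - pmin) ^ u)" using assms by simp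
  then have "measure_pmf.prob (run' n) {(s, h, r). (\<Sum>j<m. r j) \<le> n - u} \<le> (1 - pmin) ^ u / 1"
    using pmin by (intro pmf_Markov[where \<Phi> = \<Phi>]) (auto simp: \<Phi>_def)
  then show ?thesis by simp
qed

text \<open>A report that leaves the published value unchanged is possible only if the value is stale, and it
  makes the value current; hence \<open>visits\<close> plus the indicator of \<open>synced\<close> grows with every
  report and loses at most 1 at a boundary, where \<open>tau\<close> doubles.\<close>

lemma prob_few_visits:
  "measure_pmf.prob (run' n) {(s, h, r). visits h < m} \<le> 8 * 2 ^ m * (1 - pmin / 2) ^ (n - ws)"
proof -
  define \<Psi> :: "config \<Rightarrow> real" where
    "\<Psi> = (\<lambda>(s, h, r). (1 / 2) ^ (visits h + of_bool (synced s)) / real (tau s))"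
  define \<Phi> where "\<Phi> x = ennreal (\<Psi> x)" for x
  have nn: "\<Psi> x \<ge> 0" for x by (auto simp: \<Psi>_def split: prod.splits)
  have dbl: "(\<integral>\<^sup>+z. \<Phi> z \<partial>doubling' i y) \<le> \<Phi> y" if y: "mid_inv t i y" for t i y
  proof -
    obtain s h r where yy: "y = (s, h, r)" by (cases y)
    have tau1: "1 \<le> tau s" using y by (simp add: yy mid_inv_def core_def)
    from y[unfolded yy] show ?thesis
    proof (cases rule: doubling'_cases)
      case (stay d D)
      then show ?thesis by (simp add: yy \<Phi>_def \<Psi>_def synced_def)
    next
      case (boundary d D)
      have "(\<integral>\<^sup>+z. \<Phi> z \<partial>doubling' i y) \<le> (\<integral>\<^sup>+z. \<Phi> y \<partial>doubling' i y)"
        unfolding yy boundary(3) nn_integral_map_pmf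
      proof (intro nn_integral_mono_AE AE_pmfI)
        fix s' 
        have "(1 / 2 :: real) ^ (visits h + of_bool (synced (s'\<lparr>tau := D\<rparr>))) / real D \<le>
            (1 / 2) ^ visits h / (2 * real (tau s))"
          using boundary(1) tau1 by (intro frac_le power_decreasing) auto
        also have "\<dots> \<le> (1 / 2) ^ (visits h + of_bool (synced s)) / real (tau s)"
          using tau1 by (auto simp: of_bool_def divide_simps)
        finally show "\<Phi> (s'\<lparr>tau := D\<rparr>, h, r) \<le> \<Phi> (s, h, r)"
          by (auto simp: \<Phi>_def \<Psi>_def intro: ennreal_leI)
      qed
      then show ?thesis by simp
    qed
  qed
  have st: "(\<integral>\<^sup>+y. \<Phi> y \<partial>step' x) \<le> ennreal (1 - pmin / 2) * \<Phi> x"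
    if t: "ws \<le> t" "t < n" and x: "run_inv t x" for t x
  proof -
    obtain s h r where xx: "x = (s, h, r)" by (cases x)
    have inv: "run_inv t (s, h, r)" using x xx by simp
    have len: "length h = t" using inv by (simp add: run_inv_def core_def)
    have pr: "pmin \<le> prob s" "prob s \<le> 1" using prob_window[OF inv] pmax t by auto
    define s1 where "s1 = arrive True (adv h) s"
    note tr = nchanges_arrive'_True[OF inv s1_def]
    have vis: "visits (h @ [y]) = visits h + (nchanges (h @ [y]) - nchanges h)" for y
      using len t nchanges_take_le[of ws h] by (simp add: visits_def nchanges_snoc)
    have "visits h + of_bool (synced s) + 1 \<le> visits (h @ [pub s1]) + of_bool (synced s1)"
      using tr by (simp add: vis)
    then have "(1 / 2 :: real) ^ (visits (h @ [pub s1]) + of_bool (synced s1)) \<le> (1 / 2) ^ (visits h + of_bool (synced s) + 1)"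
      by (intro power_decreasing) auto
    then have "(1 / 2 :: real) ^ (visits (h @ [pub s1]) + of_bool (synced s1)) / real (tau s)
        \<le> (1 / 2) ^ (visits h + of_bool (synced s) + 1) / real (tau s)"
      by (intro divide_right_mono) auto
    moreover have "tau s1 = tau s" by (simp add: s1_def arrive_def report_def Let_def)
    moreover have "\<Psi> (arrive' True (s, h, r)) = (1 / 2 :: real) ^ (visits (h @ [pub s1]) + of_bool (synced s1)) / real (tau s1)"
      by (simp add: \<Psi>_def arrive'_def flip: s1_def)
    moreover have "(1 / 2) ^ (visits h + of_bool (synced s) + 1) / real (tau s) = \<Psi> x / 2"
      by (simp add: \<Psi>_def xx)
    ultimately have True: "\<Psi> (arrive' True (s, h, r)) \<le> \<Psi> x / 2"
      by (simp only:)
    have False: "\<Psi> (arrive' False (s, h, r)) = \<Psi> x"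
      using len t by (simp add: \<Psi>_def arrive'_def arrive_def xx visits_def nchanges_arrive'_False[OF inv] synced_def)
    have "(\<integral>\<^sup>+y. \<Phi> y \<partial>step' (s, h, r)) \<le>
        \<Phi> (arrive' True (s, h, r)) * ennreal (prob s) + \<Phi> (arrive' False (s, h, r)) * ennreal (1 - prob s)"
      by (rule nn_integral_step'_le[OF inv dbl])
    also have "\<dots> = ennreal (\<Psi> (arrive' True (s, h, r)) * prob s + \<Psi> x * (1 - prob s))"
      using pr pmin nn by (simp add: \<Phi>_def False ennreal_mult ennreal_plus)
    also have "\<dots> \<le> ennreal ((1 - pmin / 2) * \<Psi> x)"
    proof (rule ennreal_leI)
      have "\<Psi> (arrive' True (s, h, r)) * prob s \<le> \<Psi> x / 2 * prob s"
        using True pr pmin by (intro mult_right_mono) auto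
      moreover have "\<Psi> x * pmin \<le> \<Psi> x * prob s" using nn pr by (intro mult_left_mono) auto
      ultimately show "\<Psi> (arrive' True (s, h, r)) * prob s + \<Psi> x * (1 - prob s) \<le> (1 - pmin / 2) * \<Psi> x"
        by (simp add: algebra_simps)
    qed
    also have "\<dots> = ennreal (1 - pmin / 2) * \<Phi> x"
      using pmin nn by (simp add: \<Phi>_def ennreal_mult)
    finally show ?thesis by (simp add: xx)
  qed
  have ini: "\<Phi> x \<le> ennreal (8 / real n)" if x: "run_inv ws x" for x
  proof -
    obtain s h r where xx: "x = (s, h, r)" by (cases x)
    have inv: "run_inv ws (s, h, r)" using x xx by simp
    have "n \<le> 8 * tau s" using tau_window[OF inv] by (auto simp: ws_def)
    moreover have "1 \<le> tau s" using inv by (simp add: run_inv_def core_def)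
    ultimately have tau: "n \<le> 8 * tau s" "1 \<le> tau s" by auto
    have "(1 / 2 :: real) ^ (visits h + of_bool (synced s)) \<le> 1" by (intro power_le_one) auto
    then have "\<Psi> x \<le> 1 / real (tau s)"
      unfolding \<Psi>_def xx prod.case by (intro divide_right_mono) auto
    also have "\<dots> \<le> 8 / real n" using tau n_pos by (simp add: divide_simps)
    finally show ?thesis by (simp add: \<Phi>_def ennreal_leI)
  qed
  have "(\<integral>\<^sup>+x. \<Phi> x \<partial>run' (ws + (n - ws))) \<le> ennreal ((1 - pmin / 2) ^ (n - ws) * (8 / real n))"
    by (rule nn_integral_run'_le[where b = n, OF st ini]) (use pmin in \<open>auto simp: ws_def\<close>)
  then have I: "(\<integral>\<^sup>+x. \<Phi> x \<partial>run' n) \<le> ennreal ((1 - pmin / 2) ^ (n - ws) * (8 / real n))"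
    by (simp add: ws_def)
  \<comment> \<open>\<open>tau\<close> is at least \<open>n / 8\<close> at the start of the window
    and at most \<open>n\<close> at its end; the quotient is the factor 8.\<close>
  have "measure_pmf.prob (run' n) {(s, h, r). visits h < m} \<le>
      ((1 - pmin / 2) ^ (n - ws) * (8 / real n)) / ((1 / 2) ^ m / real n)"
  proof (rule pmf_Markov[OF _ _ I])
    fix x assume "x \<in> set_pmf (run' n)" and A: "x \<in> {(s, h, r). visits h < m}"
    obtain s h r where xx: "x = (s, h, r)" by (cases x)
    then have inv: "run_inv n (s, h, r)" using \<open>x \<in> set_pmf (run' n)\<close> by (auto dest: inv_run')
    have "tau s \<le> n" using tau_window[OF inv] by (auto simp: ws_def)
    moreover have "1 \<le> tau s" using inv by (simp add: run_inv_def core_def)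
    \<comment> \<open>The strict inequality \<open>visits h < m\<close> leaves room for the
      indicator of \<open>synced\<close>.\<close>
    moreover have "(1 / 2 :: real) ^ m \<le> (1 / 2) ^ (visits h + of_bool (synced s))"
      using A by (intro power_decreasing) (auto simp: xx)
    ultimately have "(1 / 2) ^ m / real n \<le> \<Psi> x"
      unfolding \<Psi>_def xx prod.case by (intro frac_le) auto
    then show "ennreal ((1 / 2) ^ m / real n) \<le> \<Phi> x" by (simp add: \<Phi>_def ennreal_leI)
  qed (use n_pos pmin in auto)
  also have "\<dots> = 8 * 2 ^ m * (1 - pmin / 2) ^ (n - ws)"
    using n_pos by (simp add: field_simps power_one_over)
  finally show ?thesis .
qed

end

section \<open>Exponential moments of the error of the visited sites\<close>

context window
begin

definition all_visited :: "real list \<Rightarrow> bool" where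
  "all_visited h \<longleftrightarrow> visited h = {..<m}"

lemma visited_subset: "visited h \<subseteq> {..<m}"
  using m by (auto simp: visited_def)

lemma finite_visited: "finite (visited h)"
  by (simp add: visited_def)

lemma visited_snoc:
  assumes "ws \<le> length h"
  shows "visited (h @ [x]) = visited h \<union> (if x \<noteq> last (0 # h) then {adv h} else {})"
  using assms nchanges_take_le[of ws h]
  by (auto simp: visited_def nchanges_snoc adv_def atLeastLessThanSuc)

text \<open>\<open>m\<close> consecutive values of the change counter meet every residue modulo
  \<open>m\<close>.\<close>

lemma all_visitedI:
  assumes "m \<le> visits h"
  shows "all_visited h"
proof -
  define a where "a = nchanges (take ws h)"
  have am: "a + m \<le> nchanges h" using assms nchanges_take_le[of ws h] by (simp add: visits_def a_def)
  have "i \<in> visited h" if "i < m" for i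
  proof -
    have "\<exists>j. a \<le> j \<and> j < a + m \<and> j mod m = i"
    proof (cases "a mod m \<le> i")
      case True
      have "(a + (i - a mod m)) mod m = (a mod m + (i - a mod m)) mod m" by (rule mod_add_left_eq[symmetric])
      then show ?thesis using True that by (intro exI[of _ "a + (i - a mod m)"]) auto
    next
      case False
      have lt: "a mod m < m" using m by simp
      define j where "j = a + (i + m - a mod m)"
      have "j mod m = (a mod m + (i + m - a mod m)) mod m" unfolding j_def by (rule mod_add_left_eq[symmetric])
      also have "a mod m + (i + m - a mod m) = i + m" using lt by linarith
      also have "(i + m) mod m = i" using that by simp
      finally have "j mod m = i" .
      moreover have "a \<le> j" "j < a + m" using False lt that by (auto simp: j_def)
      ultimately show ?thesis by blast
    qed
    then show ?thesis using am by (auto simp: visited_def a_def[symmetric] image_iff)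
  qed
  then show ?thesis using visited_subset by (auto simp: all_visited_def)
qed

text \<open>Exponential moment of the amount by which the estimates of the visited sites fall short
  of \<open>r j + gain\<close>. The offsets change only at reports, so this measures how far
  resampling erodes the overestimate left by the last report.\<close>

definition potential :: "real \<Rightarrow> config \<Rightarrow> real" where
  "potential \<theta> = (\<lambda>(s, h, r). exp (- \<theta> * (\<Sum>j\<in>visited h. nhat s j - (real (r j) + gain))))"

text \<open>Between a boundary and the next report the published value still is the sum of the estimates
  before the boundary, so this stale value needs a term of its own.\<close>

definition stale :: "real \<Rightarrow> config \<Rightarrow> real" where
  "stale \<theta> = (\<lambda>(s, h, r). if all_visited h then exp (- \<theta> * (pub s - (\<Sum>j<m. real (r j) + gain))) else 0)"

text \<open>Every boundary multiplies \<open>tau\<close> by at least 2, so the factor \<open>tau powr - \<kappa>\<close>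
  pays for the growth of the other factor there.\<close>

definition weight :: "real \<Rightarrow> real \<Rightarrow> config \<Rightarrow> real" where
  "weight \<theta> \<kappa> x = (potential \<theta> x + (if synced (fst x) then 0 else stale \<theta> x)) * real (tau (fst x)) powr - \<kappa>"

lemma weight_nonneg: "weight \<theta> \<kappa> x \<ge> 0"
  by (auto simp: weight_def potential_def stale_def split: prod.splits intro!: mult_nonneg_nonneg add_nonneg_nonneg)

text \<open>If the published value is current and all \<open>m\<close> sites are visited, both
  exponents agree; otherwise the stale term is present or \<open>stale\<close> is 0. The bracket in
  \<open>weight\<close> thus controls the published value in every case.\<close>

lemma stale_le:
  assumes "core t x"
  shows "stale \<theta> x \<le> potential \<theta> x + (if synced (fst x) then 0 else stale \<theta> x)"
proof -
  obtain s h r where x: "x = (s, h, r)" by (cases x)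
  have "stale \<theta> x \<le> potential \<theta> x" if "synced s"
  proof (cases "all_visited h")
    case True
    then have v: "visited h = {..<m}" by (simp add: all_visited_def)
    have "pub s = (\<Sum>j<m. nhat s j)" using that sum_nhat assms by (simp add: x synced_def)
    then show ?thesis using True by (simp add: x stale_def potential_def v sum_subtractf)
  qed (simp add: x stale_def potential_def)
  then show ?thesis by (auto simp: x potential_def)
qed

lemma weight_arrive'_False:
  assumes "run_inv t (s, h, r)" "ws \<le> t"
  shows "weight \<theta> \<kappa> (arrive' False (s, h, r)) = weight \<theta> \<kappa> (s, h, r)"
proof -
  have "visited (h @ [pub s]) = visited h"
    using assms by (subst visited_snoc) (auto simp: run_inv_def core_def)
  then show ?thesis
    by (simp add: weight_def potential_def stale_def all_visited_def arrive'_def arrive_def synced_def)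
qed

text \<open>The term of the reporting site becomes \<open>1 / prob s - 1 / pmax\<close>, which is at
  least its previous value and nonnegative, so neither updating it nor admitting the site to
  \<open>visited\<close> can raise the potential. The report also publishes a current value, which
  removes the stale term.\<close>

lemma weight_arrive'_True:
  assumes inv: "run_inv t (s, h, r)" and t: "ws \<le> t" "t < n" and th: "\<theta> \<ge> 0"
  shows "weight \<theta> \<kappa> (arrive' True (s, h, r)) \<le> weight \<theta> \<kappa> (s, h, r)"
proof -
  define i where "i = adv h"
  define s1 where "s1 = arrive True i s"
  define r1 where "r1 = r(i := cnt s i + 1)"
  define h1 where "h1 = h @ [pub s1]"
  have eq: "arrive' True (s, h, r) = (s1, h1, r1)" by (simp add: arrive'_def s1_def h1_def r1_def i_def)
  have sy: "synced s1" and tau: "tau s1 = tau s"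
    using nchanges_arrive'_True[OF inv] by (auto simp: s1_def i_def arrive_def report_def Let_def)
  have p: "0 < prob s" "prob s \<le> pmax" using prob_window[OF inv] t pmin by auto
  have v: "visited h1 = visited h \<or> visited h1 = insert i (visited h)"
    using inv t by (auto simp: h1_def visited_snoc i_def run_inv_def core_def)
  have new: "nhat s1 i - (real (r1 i) + gain) = 1 / prob s - 1 / pmax"
    by (simp add: s1_def arrive_def report_def Let_def r1_def gain_def)
  have new0: "1 / prob s - 1 / pmax \<ge> 0" using p by (simp add: frac_le)
  have "nbar s i \<le> r i" "nhat s i = est (prob s) (nbar s i)" using inv by (auto simp: run_inv_def core_def)
  \<comment> \<open>For an empty record the estimate 0 is at most the generic
    \<open>1 / prob s - 1\<close>.\<close>
  then have old: "nhat s i - (real (r i) + gain) \<le> 1 / prob s - 1 / pmax"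
  proof (cases "nbar s i = 0")
    case True
    have "1 / prob s \<ge> 1" using inv new_prob_le_1[of k \<epsilon> "tau s"] p by (auto simp: run_inv_def core_def)
    then show ?thesis using True \<open>nhat s i = _\<close> by (simp add: est_def gain_def)
  qed (simp add: est_def gain_def)
  have other: "nhat s1 j - (real (r1 j) + gain) = nhat s j - (real (r j) + gain)" if "j \<noteq> i" for j
    using that by (simp add: s1_def arrive_def report_def Let_def r1_def)
  have ge: "nhat s j - (real (r j) + gain) \<le> nhat s1 j - (real (r1 j) + gain)" for j
    using other[of j] new old by (cases "j = i") auto
  have "(\<Sum>j\<in>visited h. nhat s j - (real (r j) + gain)) \<le> (\<Sum>j\<in>visited h. nhat s1 j - (real (r1 j) + gain))"
    by (intro sum_mono ge)
  also have "\<dots> \<le> (\<Sum>j\<in>visited h1. nhat s1 j - (real (r1 j) + gain))"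
    using v new new0 finite_visited[of h] by (intro sum_mono2) (auto simp: finite_visited)
  finally have "potential \<theta> (s1, h1, r1) \<le> potential \<theta> (s, h, r)"
    using th by (simp add: potential_def mult_left_mono)
  also have "\<dots> \<le> potential \<theta> (s, h, r) + (if synced s then 0 else stale \<theta> (s, h, r))"
    by (auto simp: stale_def)
  finally show ?thesis unfolding eq weight_def using sy tau by (intro mult_mono) (auto simp: potential_def stale_def)
qed

lemma nn_integral_weight_doubling':
  assumes y: "mid_inv t i y" and t: "t \<le> n" and th: "0 \<le> \<theta>" "\<theta> \<le> \<mu> * pmin" and mu: "0 \<le> \<mu>" "\<mu> \<le> 1 / 2"
    and ka: "\<kappa> \<ge> 0" "2 powr \<kappa> = (1 + 2 * \<mu>\<^sup>2) ^ m + 1"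
  shows "(\<integral>\<^sup>+z. ennreal (weight \<theta> \<kappa> z) \<partial>doubling' i y) \<le> ennreal (weight \<theta> \<kappa> y)"
proof -
  obtain s h r where yy: "y = (s, h, r)" by (cases y)
  have core: "core t (s, h, r)" using y by (simp add: yy mid_inv_def)
  have tau1: "1 \<le> tau s" using core by (simp add: core_def)
  from y[unfolded yy] show ?thesis
  proof (cases rule: doubling'_cases)
    case (stay d D)
    then show ?thesis by (simp add: yy weight_def potential_def stale_def synced_def)
  next
    case (boundary d D)
    define s1 where "s1 = s\<lparr>dsum := D, dlast := d\<rparr>"
    define G where "G = (1 + 2 * \<mu>\<^sup>2) ^ m"
    have D: "1 \<le> D" "D \<le> n" using boundary tau1 t by auto
    have thD: "\<theta> \<le> \<mu> * new_prob k \<epsilon> D"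
      using th(2) mult_left_mono[OF pmin_le_new_prob[OF D] mu(1)] by simp
    have pub: "pub s' = pub s" if "s' \<in> set_pmf (Defs.boundary k \<epsilon> D s1)" for s'
      using pub_boundary[OF that] by (simp add: s1_def)
    have c0: "0 \<le> stale \<theta> y" "0 \<le> potential \<theta> y" by (auto simp: yy stale_def potential_def)
    have "(\<integral>\<^sup>+z. ennreal (weight \<theta> \<kappa> z) \<partial>doubling' i y) =
        (\<integral>\<^sup>+s'. ennreal (weight \<theta> \<kappa> (s'\<lparr>tau := D\<rparr>, h, r)) \<partial>Defs.boundary k \<epsilon> D s1)"
      by (simp add: yy boundary(3) s1_def)
    also have "\<dots> \<le> (\<integral>\<^sup>+s'. (ennreal (exp (- \<theta> * (\<Sum>j\<in>visited h. nhat s' j - (real (r j) + gain)))) + ennreal (stale \<theta> y))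
        * ennreal (real D powr - \<kappa>) \<partial>Defs.boundary k \<epsilon> D s1)"
    proof (intro nn_integral_mono_AE AE_pmfI)
      fix s' assume "s' \<in> set_pmf (Defs.boundary k \<epsilon> D s1)"
      then have "stale \<theta> (s'\<lparr>tau := D\<rparr>, h, r) = stale \<theta> y" using pub by (simp add: stale_def yy)
      then have "weight \<theta> \<kappa> (s'\<lparr>tau := D\<rparr>, h, r) \<le>
          (exp (- \<theta> * (\<Sum>j\<in>visited h. nhat s' j - (real (r j) + gain))) + stale \<theta> y) * real D powr - \<kappa>"
        unfolding weight_def using c0 by (intro mult_mono add_mono) (auto simp: potential_def)
      then show "ennreal (weight \<theta> \<kappa> (s'\<lparr>tau := D\<rparr>, h, r)) \<le>
          (ennreal (exp (- \<theta> * (\<Sum>j\<in>visited h. nhat s' j - (real (r j) + gain)))) + ennreal (stale \<theta> y)) * ennreal (real D powr - \<kappa>)"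
        using c0 by (simp add: ennreal_leI flip: ennreal_mult ennreal_plus)
    qed
    also have "\<dots> = ((\<integral>\<^sup>+s'. ennreal (exp (- \<theta> * (\<Sum>j\<in>visited h. nhat s' j - (real (r j) + gain)))) \<partial>Defs.boundary k \<epsilon> D s1)
        + ennreal (stale \<theta> y)) * ennreal (real D powr - \<kappa>)"
      by (simp add: nn_integral_multc nn_integral_add)
    also have "\<dots> \<le> (ennreal ((1 + 2 * \<mu>\<^sup>2) ^ card (visited h) * exp (- \<theta> * (\<Sum>j\<in>visited h. nhat s1 j - (real (r j) + gain))))
        + ennreal (stale \<theta> y)) * ennreal (real D powr - \<kappa>)"
      using core boundary(4,5) th thD mu visited_subset[of h] m
      by (intro mult_right_mono add_right_mono nn_integral_boundary_exp_nhat) (auto simp: s1_def core_def)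
    also have "\<dots> = ennreal (((1 + 2 * \<mu>\<^sup>2) ^ card (visited h) * potential \<theta> y + stale \<theta> y) * real D powr - \<kappa>)"
      using c0 by (simp add: potential_def yy s1_def flip: ennreal_mult ennreal_plus)
    also have "\<dots> \<le> ennreal (weight \<theta> \<kappa> y)"
    proof (rule ennreal_leI)
      define W where "W = potential \<theta> y + (if synced s then 0 else stale \<theta> y)"
      have G1: "G \<ge> 1" by (simp add: G_def)
      have "card (visited h) \<le> m" using card_mono[OF _ visited_subset[of h]] by simp
      then have cG: "(1 + 2 * \<mu>\<^sup>2) ^ card (visited h) \<le> G" unfolding G_def by (intro power_increasing) auto
      have pW: "potential \<theta> y \<le> W" "W \<ge> 0" using c0 by (auto simp: W_def)
      have sW: "stale \<theta> y \<le> W" using stale_le[of t y \<theta>] core by (simp add: W_def yy)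
      have "(1 + 2 * \<mu>\<^sup>2) ^ card (visited h) * potential \<theta> y + stale \<theta> y \<le> G * W + W"
        using cG pW sW c0 G1 by (intro add_mono mult_mono) auto
      also have "\<dots> = 2 powr \<kappa> * W" by (simp add: ka(2) G_def algebra_simps)
      finally have "((1 + 2 * \<mu>\<^sup>2) ^ card (visited h) * potential \<theta> y + stale \<theta> y) * real D powr - \<kappa>
          \<le> 2 powr \<kappa> * W * (2 * real (tau s)) powr - \<kappa>"
        using boundary(1) tau1 ka pW by (intro mult_mono powr_mono2') auto
      also have "\<dots> = W * real (tau s) powr - \<kappa>"
        by (simp add: powr_mult powr_minus field_simps)
      finally show "((1 + 2 * \<mu>\<^sup>2) ^ card (visited h) * potential \<theta> y + stale \<theta> y) * real D powr - \<kappa> \<le> weight \<theta> \<kappa> y"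
        unfolding weight_def W_def yy fst_conv .
    qed
    finally show ?thesis .
  qed
qed

text \<open>Over the window \<open>tau\<close> grows at most from \<open>n / 8\<close> to
  \<open>n\<close>, so all boundaries together cost \<open>8 powr \<kappa>\<close>, the cube of the
  cost of one. Markov's inequality applied to \<open>weight\<close> gives the tail.\<close>

lemma prob_low_published:
  assumes th: "\<theta> = \<mu> * pmin" and mu: "0 \<le> \<mu>" "\<mu> \<le> 1 / 2"
  shows "measure_pmf.prob (run' n)
      {(s, h, r). all_visited h \<and> pub s - (\<Sum>j<m. real (r j) + gain) \<le> - \<Delta>}
    \<le> ((1 + 2 * \<mu>\<^sup>2) ^ m + 1) ^ 3 * exp (- \<theta> * \<Delta>)"
proof -
  define g where "g = (1 + 2 * \<mu>\<^sup>2) ^ m + 1"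
  define \<kappa> where "\<kappa> = log 2 g"
  have "(1 + 2 * \<mu>\<^sup>2) ^ m \<ge> 1" by simp
  then have g: "g \<ge> 2" by (simp add: g_def)
  have ka: "\<kappa> \<ge> 0" "2 powr \<kappa> = g" using g by (auto simp: \<kappa>_def)
  have th0: "\<theta> \<ge> 0" using th mu pmin by simp
  have st: "(\<integral>\<^sup>+y. ennreal (weight \<theta> \<kappa> y) \<partial>step' x) \<le> ennreal 1 * ennreal (weight \<theta> \<kappa> x)"
    if t: "ws \<le> t" "t < n" and x: "run_inv t x" for t x
  proof -
    obtain s h r where xx: "x = (s, h, r)" by (cases x)
    have inv: "run_inv t (s, h, r)" using x xx by simp
    have pr: "0 \<le> prob s" "prob s \<le> 1" using prob_window[OF inv] pmin pmax t by auto
    have "(\<integral>\<^sup>+y. ennreal (weight \<theta> \<kappa> y) \<partial>step' (s, h, r)) \<le>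
        ennreal (weight \<theta> \<kappa> (arrive' True (s, h, r))) * ennreal (prob s)
        + ennreal (weight \<theta> \<kappa> (arrive' False (s, h, r))) * ennreal (1 - prob s)"
      using t th th0 mu ka
      by (intro nn_integral_step'_le[OF inv] nn_integral_weight_doubling'[where \<mu> = \<mu> and t = "Suc t"]) (auto simp: g_def)
    also have "\<dots> \<le> ennreal (weight \<theta> \<kappa> x) * ennreal (prob s) + ennreal (weight \<theta> \<kappa> x) * ennreal (1 - prob s)"
      unfolding xx using weight_arrive'_True[OF inv t th0] weight_arrive'_False[OF inv t(1)]
      by (intro add_mono mult_right_mono ennreal_leI) auto
    also have "\<dots> = ennreal (weight \<theta> \<kappa> x * prob s + weight \<theta> \<kappa> x * (1 - prob s))"
      using pr weight_nonneg[of \<theta> \<kappa> x] by (simp add: ennreal_mult ennreal_plus)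
    also have "weight \<theta> \<kappa> x * prob s + weight \<theta> \<kappa> x * (1 - prob s) = weight \<theta> \<kappa> x"
      by (simp add: algebra_simps)
    finally show ?thesis by (simp add: xx)
  qed
  have ini: "ennreal (weight \<theta> \<kappa> x) \<le> ennreal ((real n / 8) powr - \<kappa>)" if x: "run_inv ws x" for x
  proof -
    obtain s h r where xx: "x = (s, h, r)" by (cases x)
    have inv: "run_inv ws (s, h, r)" using x xx by simp
    have tau: "n \<le> 8 * tau s" using tau_window[OF inv] by (auto simp: ws_def)
    \<comment> \<open>Nothing has been visited at time \<open>ws\<close>, so the potential is 1 and
      the stale term vanishes.\<close>
    have v: "visited h = {}" using x by (auto simp: xx visited_def run_inv_def core_def)
    moreover have "0 \<in> {..<m}" using m by simp
    ultimately have "\<not> all_visited h" by (auto simp: all_visited_def)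
    then have "weight \<theta> \<kappa> x = real (tau s) powr - \<kappa>"
      by (simp add: weight_def potential_def stale_def xx v)
    also have "\<dots> \<le> (real n / 8) powr - \<kappa>" using tau n_pos ka by (intro powr_mono2') auto
    finally show ?thesis by (rule ennreal_leI)
  qed
  have "(\<integral>\<^sup>+x. ennreal (weight \<theta> \<kappa> x) \<partial>run' (ws + (n - ws))) \<le> ennreal (1 ^ (n - ws) * (real n / 8) powr - \<kappa>)"
    by (rule nn_integral_run'_le[where b = n, OF st ini]) (auto simp: ws_def)
  then have I: "(\<integral>\<^sup>+x. ennreal (weight \<theta> \<kappa> x) \<partial>run' n) \<le> ennreal ((real n / 8) powr - \<kappa>)"
    by (simp add: ws_def)
  have "measure_pmf.prob (run' n) {(s, h, r). all_visited h \<and> pub s - (\<Sum>j<m. real (r j) + gain) \<le> - \<Delta>} \<le>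
      ((real n / 8) powr - \<kappa>) / (exp (\<theta> * \<Delta>) * real n powr - \<kappa>)"
  proof (rule pmf_Markov[OF _ _ I])
    fix x assume "x \<in> set_pmf (run' n)"
      and A: "x \<in> {(s, h, r). all_visited h \<and> pub s - (\<Sum>j<m. real (r j) + gain) \<le> - \<Delta>}"
    obtain s h r where xx: "x = (s, h, r)" by (cases x)
    then have inv: "run_inv n (s, h, r)" using \<open>x \<in> set_pmf (run' n)\<close> by (auto dest: inv_run')
    have "tau s \<le> n" using tau_window[OF inv] by (auto simp: ws_def)
    moreover have "1 \<le> tau s" using inv by (simp add: run_inv_def core_def)
    ultimately have tau: "tau s \<le> n" "1 \<le> tau s" by auto
    have "\<theta> * \<Delta> \<le> - \<theta> * (pub s - (\<Sum>j<m. real (r j) + gain))"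
      using A mult_left_mono[OF _ th0, of "pub s - (\<Sum>j<m. real (r j) + gain)" "- \<Delta>"] by (simp add: xx)
    then have "exp (\<theta> * \<Delta>) \<le> stale \<theta> x" using A by (simp add: stale_def xx)
    also have "\<dots> \<le> potential \<theta> x + (if synced (fst x) then 0 else stale \<theta> x)"
      using inv by (intro stale_le[of n]) (simp add: run_inv_def xx)
    finally have "exp (\<theta> * \<Delta>) * real n powr - \<kappa> \<le> weight \<theta> \<kappa> x"
      unfolding weight_def using tau ka by (intro mult_mono powr_mono2') (auto simp: xx intro: order_trans[OF exp_ge_zero])
    then show "ennreal (exp (\<theta> * \<Delta>) * real n powr - \<kappa>) \<le> ennreal (weight \<theta> \<kappa> x)" by (rule ennreal_leI)
  qed (use n_pos in auto)
  also have "\<dots> = 8 powr \<kappa> * exp (- \<theta> * \<Delta>)"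
    using n_pos by (simp add: powr_divide powr_minus exp_minus field_simps)
  also have "8 powr \<kappa> = g ^ 3"
  proof -
    have "8 powr \<kappa> = (2 powr 3) powr \<kappa>" by simp
    also have "\<dots> = (2 powr \<kappa>) powr 3" by (simp only: powr_powr mult.commute)
    finally show ?thesis using g by (simp add: ka powr_numeral)
  qed
  finally show ?thesis by (simp add: g_def)
qed

end

subsection \<open>The bias of the published estimate\<close>

lemma one_minus_power_le_exp:
  fixes x :: real
  assumes "x \<le> 1"
  shows "(1 - x) ^ j \<le> exp (- (x * real j))"
proof -
  have "(1 - x) ^ j \<le> exp (- x) ^ j"
    using assms exp_ge_add_one_self[of "- x"] by (intro power_mono) auto
  then show ?thesis by (simp add: mult_ac flip: exp_of_nat_mult)
qed

context window
begin

lemma prob_run':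
  "measure_pmf.prob (hyz_run k \<epsilon> adv n) {(s, h). Q s} = measure_pmf.prob (run' n) {(s, h, r). Q s}"
  by (simp flip: run'_project add: vimage_def split_beta')

text \<open>Long enough for at least \<open>m / 256\<close> expected reports, short enough to cost
  only an eighth of \<open>m / pmax\<close>.\<close>

definition lag :: nat where
  "lag = nat \<lfloor>real m / (8 * pmax)\<rfloor>"

lemma inverse_pmax: "1 / pmax = \<epsilon> * real n / (8 * sqrt (real k))"
  by (simp add: pmax_def)

lemma lag:
  "real lag \<le> real m / (8 * pmax)" "real m / (16 * pmax) \<le> real lag" "lag \<le> n - ws"
proof -
  define x where "x = real m / (8 * pmax)"
  have m1: "1 \<le> real m" using m by simp
  have "1 \<le> 1 / (8 * pmax)" using pmax by (simp add: divide_simps)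
  also have "\<dots> \<le> x" unfolding x_def using m1 pmax by (intro divide_right_mono) auto
  finally have x1: "x \<ge> 1" .
  have l: "real lag = of_int \<lfloor>x\<rfloor>" using x1 by (simp add: lag_def flip: x_def)
  show le: "real lag \<le> real m / (8 * pmax)" unfolding l x_def by (rule of_int_floor_le)
  have "1 \<le> real_of_int \<lfloor>x\<rfloor>" using x1 by simp
  then have "x / 2 \<le> of_int \<lfloor>x\<rfloor>" using real_of_int_floor_add_one_gt[of x] by linarith
  then show "real m / (16 * pmax) \<le> real lag" unfolding l by (simp add: x_def)
  \<comment> \<open>The bound \<open>\<epsilon> \<le> 1 / sqrt k\<close>, with
    \<open>m \<le> k\<close>, keeps the lag inside the window.\<close>
  have "real m * \<epsilon> \<le> real k * (1 / sqrt (real k))"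
    using m eps by (intro mult_mono) auto
  also have "\<dots> = sqrt (real k)" by (simp add: real_div_sqrt)
  finally have me: "real m * \<epsilon> \<le> sqrt (real k)" .
  have "real lag \<le> real m * (1 / pmax) / 8" using le by simp
  also have "\<dots> = real m * \<epsilon> * real n / (64 * sqrt (real k))" unfolding inverse_pmax by simp
  also have "\<dots> \<le> sqrt (real k) * real n / (64 * sqrt (real k))"
    using me n_pos by (intro divide_right_mono mult_right_mono) auto
  also have "\<dots> = real n / 64" using k_pos by simp
  finally show "lag \<le> n - ws" by (simp add: ws_def)
qed

lemma prob_no_recent_report_lag:
  "measure_pmf.prob (run' n) {(s, h, r). (\<Sum>j<m. r j) \<le> n - lag} \<le> exp (- real m / 256)"
proof -
  have "measure_pmf.prob (run' n) {(s, h, r). (\<Sum>j<m. r j) \<le> n - lag} \<le> (1 - pmin) ^ lag"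
    by (rule prob_no_recent_report[OF lag(3)])
  also have "\<dots> \<le> exp (- (pmin * real lag))" using pmin by (intro one_minus_power_le_exp)
  also have "\<dots> \<le> exp (- real m / 256)"
    using mult_left_mono[OF lag(2), of pmin] pmin by (simp add: pmax(3))
  finally show ?thesis .
qed

text \<open>Outside \<open>A\<close>, \<open>B\<close> and \<open>C\<close> the overestimate starts
  from \<open>m * gain\<close>, at least 7/8 of \<open>m / pmax\<close>, and loses at most 1/4 to
  the resampling noise and 1/8 to the events after the last report; half of \<open>m / pmax\<close>
  remains.\<close>

lemma prob_published_large:
  assumes k: "16 * m \<le> k" "k \<le> 32 * m"
  shows "measure_pmf.prob (hyz_run k \<epsilon> adv n) {(s, h). pub s - real n > sqrt (real k) * \<epsilon> * real n / 512}
    \<ge> 1 - 17 * exp (- real k / 6400000)"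
proof -
  \<comment> \<open>Small enough that the linear saving \<open>\<mu> * m / 64\<close> in the
    exponent for \<open>C\<close> beats the quadratic loss \<open>6 * \<mu>^2 * m\<close>.\<close>
  define \<mu> :: real where "\<mu> = 1 / 1000"
  define \<Delta> where "\<Delta> = real m / (4 * pmax)"
  define A where "A = {(s :: hyz_state, h :: real list, r). (\<Sum>j<m. r j :: nat) \<le> n - lag}"
  define B where "B = {(s :: hyz_state, h :: real list, r :: nat \<Rightarrow> nat). visits h < m}"
  define C where "C = {(s :: hyz_state, h :: real list, r :: nat \<Rightarrow> nat). all_visited h \<and> pub s - (\<Sum>j<m. real (r j) + gain) \<le> - \<Delta>}"
  define S where "S = {(s :: hyz_state, h :: real list, r :: nat \<Rightarrow> nat). pub s - real n > sqrt (real k) * \<epsilon> * real n / 512}"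
  have A: "measure_pmf.prob (run' n) A \<le> exp (- real k / 6400000)"
  proof -
    have "measure_pmf.prob (run' n) A \<le> exp (- real m / 256)" unfolding A_def by (rule prob_no_recent_report_lag)
    also have "\<dots> \<le> exp (- real k / 6400000)" using k by simp
    finally show ?thesis .
  qed
  have B: "measure_pmf.prob (run' n) B \<le> 8 * exp (- real k / 6400000)"
  proof -
    have "measure_pmf.prob (run' n) B \<le> 8 * 2 ^ m * (1 - pmin / 2) ^ (n - ws)" unfolding B_def by (rule prob_few_visits)
    also have "\<dots> \<le> 8 * exp (real m) * exp (- (pmin / 2 * real (n - ws)))"
    proof (intro mult_mono one_minus_power_le_exp)
      have "(2 :: real) ^ m \<le> exp 1 ^ m" using exp_ge_add_one_self[of 1] by (intro power_mono) auto
      also have "\<dots> = exp (real m)" by (simp flip: exp_of_nat_mult)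
      finally show "(2 :: real) ^ m \<le> exp (real m)" .
      show "0 \<le> (1 - pmin / 2) ^ (n - ws)" using pmin by (intro zero_le_power) simp
      show "pmin / 2 \<le> 1" using pmin by simp
    qed simp_all
    also have "\<dots> = 8 * exp (real m - pmin / 2 * real (n - ws))"
      by (simp only: mult.assoc flip: exp_add) simp
    also have "\<dots> \<le> 8 * exp (- real k / 6400000)"
    proof -
      \<comment> \<open>This leads to \<open>pmin * n \<ge> k / 2\<close>, so the decay over the
        window is at least \<open>k / 8 \<ge> 2 * m\<close> in the exponent and outweighs
        \<open>2 ^ m\<close>.\<close>
      have "real k * \<epsilon> \<le> real k * (1 / sqrt (real k))" using eps by (intro mult_left_mono) auto
      then have "real k * \<epsilon> \<le> sqrt (real k)" by (simp add: real_div_sqrt)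
      then have "real k / 2 \<le> pmin * real n" using eps n_pos by (simp add: pmin_def divide_simps mult_ac)
      moreover have "pmin / 2 * (real n / 2) \<le> pmin / 2 * real (n - ws)"
        using pmin by (intro mult_left_mono) (auto simp: ws_def)
      ultimately have "real m - pmin / 2 * real (n - ws) \<le> - real k / 6400000" using k by (simp add: field_simps)
      then show ?thesis by simp
    qed
    finally show ?thesis .
  qed
  have C: "measure_pmf.prob (run' n) C \<le> 8 * exp (- real k / 6400000)"
  proof -
    have "measure_pmf.prob (run' n) C \<le> ((1 + 2 * \<mu>\<^sup>2) ^ m + 1) ^ 3 * exp (- (\<mu> * pmin) * \<Delta>)"
      unfolding C_def by (rule prob_low_published[OF refl]) (auto simp: \<mu>_def)
    also have "\<dots> \<le> (2 * exp (2 * \<mu>\<^sup>2 * real m)) ^ 3 * exp (- (\<mu> * pmin) * \<Delta>)"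
    proof (intro mult_right_mono power_mono)
      have "(1 + 2 * \<mu>\<^sup>2) ^ m \<le> exp (2 * \<mu>\<^sup>2) ^ m" using exp_ge_add_one_self[of "2 * \<mu>\<^sup>2"] by (intro power_mono) auto
      also have "\<dots> = exp (2 * \<mu>\<^sup>2 * real m)" by (simp add: mult_ac flip: exp_of_nat_mult)
      finally have "(1 + 2 * \<mu>\<^sup>2) ^ m \<le> exp (2 * \<mu>\<^sup>2 * real m)" .
      moreover have "1 \<le> exp (2 * \<mu>\<^sup>2 * real m)" by simp
      ultimately show "(1 + 2 * \<mu>\<^sup>2) ^ m + 1 \<le> 2 * exp (2 * \<mu>\<^sup>2 * real m)" by linarith
    qed auto
    also have "\<dots> = 8 * exp (6 * \<mu>\<^sup>2 * real m - \<mu> * pmin * \<Delta>)"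
    proof -
      have "exp (2 * \<mu>\<^sup>2 * real m) ^ 3 = exp (6 * \<mu>\<^sup>2 * real m)" by (simp flip: exp_of_nat_mult)
      then show ?thesis by (simp add: power_mult_distrib mult.assoc flip: exp_add)
    qed
    also have "\<dots> \<le> 8 * exp (- real k / 6400000)"
    proof -
      have "pmin * \<Delta> = real m / 64" using pmin by (simp add: \<Delta>_def pmax(3))
      then have "\<mu> * pmin * \<Delta> = real m / 64000" by (simp add: \<mu>_def mult_ac)
      moreover have "6 * \<mu>\<^sup>2 * real m = 6 * real m / 1000000" by (simp add: \<mu>_def power2_eq_square)
      ultimately have "6 * \<mu>\<^sup>2 * real m - \<mu> * pmin * \<Delta> \<le> - real k / 6400000" using k by linarith
      then show ?thesis by simp
    qed
    finally show ?thesis .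
  qed
  have "- (A \<union> B \<union> C) \<subseteq> S"
  proof
    fix x assume x: "x \<in> - (A \<union> B \<union> C)"
    obtain s h r where xx: "x = (s, h, r)" by (cases x)
    have a: "n - lag < (\<Sum>j<m. r j)" using x by (auto simp: A_def xx)
    have "m \<le> visits h" using x by (auto simp: B_def xx)
    then have c: "pub s - (\<Sum>j<m. real (r j) + gain) > - \<Delta>" using x all_visitedI by (auto simp: C_def xx)
    have "real n - real lag < real (\<Sum>j<m. r j)" using a by linarith
    then have "pub s - real n > real m * gain - \<Delta> - real lag" using c by (simp add: sum.distrib)
    moreover have "real m * gain \<ge> real m * (7 / 8 / pmax)"
    proof (intro mult_left_mono)
      have "1 \<le> 1 / (8 * pmax)" using pmax by (simp add: divide_simps)
      then show "7 / 8 / pmax \<le> gain" by (simp add: gain_def)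
    qed simp
    moreover have "sqrt (real k) * \<epsilon> * real n / 512 \<le> real m / (2 * pmax)"
    proof -
      have "sqrt (real k) * \<epsilon> * real n / 512 = (real k / sqrt (real k)) * \<epsilon> * real n / 512"
        by (simp add: real_div_sqrt)
      also have "\<dots> = real k / 32 * (\<epsilon> * real n) / (16 * sqrt (real k))" by simp
      also have "\<dots> \<le> real m * (\<epsilon> * real n) / (16 * sqrt (real k))"
        using k eps by (intro divide_right_mono mult_right_mono) auto
      also have "\<dots> = real m * (1 / pmax) / 2" unfolding inverse_pmax by simp
      also have "\<dots> = real m / (2 * pmax)" by simp
      finally show ?thesis .
    qed
    moreover have "real m * (7 / 8 / pmax) - \<Delta> - real lag \<ge> real m / (2 * pmax)"
      using lag(1) by (simp add: \<Delta>_def)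
    ultimately have "pub s - real n > sqrt (real k) * \<epsilon> * real n / 512" by linarith
    then show "x \<in> S" by (simp add: S_def xx)
  qed
  then have "measure_pmf.prob (run' n) (- (A \<union> B \<union> C)) \<le> measure_pmf.prob (run' n) S"
    by (intro measure_pmf.finite_measure_mono) auto
  then have "1 - measure_pmf.prob (run' n) (A \<union> B \<union> C) \<le> measure_pmf.prob (run' n) S"
    using measure_pmf.prob_compl[of "A \<union> B \<union> C" "run' n"] by (simp only: Compl_eq_Diff_UNIV space_measure_pmf sets_measure_pmf UNIV_I)
  moreover have "measure_pmf.prob (run' n) (A \<union> B \<union> C) \<le>
      measure_pmf.prob (run' n) A + measure_pmf.prob (run' n) B + measure_pmf.prob (run' n) C"
    using measure_Un_le[of "A \<union> B" "measure_pmf (run' n)" C] measure_Un_le[of A "measure_pmf (run' n)" B] by simp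
  ultimately have "1 - 17 * exp (- real k / 6400000) \<le> measure_pmf.prob (run' n) S" using A B C by linarith
  then show ?thesis by (simp add: prob_run' S_def)
qed

text \<open>A boundary never changes the published value, and with one site a report sets it to the
  count plus \<open>1 / p - 1\<close>. The bound therefore holds surely from the first report in the
  window on, and resampling noise cannot enter.\<close>

lemma published_ge_single_site:
  assumes "m = 1" "(s, h, r) \<in> set_pmf (run' t)" "t \<le> n" "ws < r 0"
  shows "pub s \<ge> real (r 0) + gain"
  using assms(2-4)
proof (induction t arbitrary: s h r)
  case (Suc t)
  then obtain s0 h0 r0 where 0: "(s0, h0, r0) \<in> set_pmf (run' t)" and y: "(s, h, r) \<in> set_pmf (step' (s0, h0, r0))"
    by auto
  have inv: "run_inv t (s0, h0, r0)" using 0 by (rule inv_run')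
  have a0: "adv h0 = 0" using adv_less[of h0] assms(1) by simp
  obtain b where b: "(s, h, r) \<in> set_pmf (doubling' 0 (arrive' b (s0, h0, r0)))"
    using y by (auto simp: step'_def a0)
  define s1 where "s1 = arrive b 0 s0"
  have pub: "pub s = pub s1" and r: "r = (if b then r0(0 := cnt s0 0 + 1) else r0)"
    using b pub_doubling by (auto simp: doubling'_def arrive'_def a0 s1_def)
  show ?case
  proof (cases b)
    case False
    then show ?thesis using Suc 0 pub r by (simp add: s1_def arrive_def)
  next
    case True
    have "core (Suc t) (s1, h0 @ [pub s1], r)"
      using mid_inv_arrive'[OF inv, of b] True by (simp add: mid_inv_def arrive'_def a0 s1_def r)
    from sum_nhat[OF this] have "pub s1 = nhat s1 0"
      using nchanges_arrive'_True(2)[OF inv refl] True unfolding a0 by (simp add: s1_def synced_def assms(1))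
    also have "\<dots> = real (r 0) - 1 + 1 / prob s0"
      using True by (simp add: s1_def arrive_def report_def Let_def r)
    finally have eq: "pub s = real (r 0) - 1 + 1 / prob s0" using pub by simp
    have "(\<Sum>j<m. cnt s0 j) = t" using inv by (simp add: run_inv_def core_def)
    then have "cnt s0 0 = t" by (simp add: assms(1))
    then have t: "ws \<le> t" using Suc.prems(3) True by (simp add: r)
    have "prob s0 \<le> pmax" "0 < prob s0" using prob_window[OF inv t] Suc.prems(2) pmin by auto
    then have "1 / pmax \<le> 1 / prob s0" by (simp add: frac_le)
    then show ?thesis using eq by (simp add: gain_def)
  qed
qed simp

text \<open>The only bad event is the absence of a recent report. Otherwise the overestimate exceeds
  \<open>1 / (2 * pmax)\<close>, which is \<open>\<epsilon> * n / (16 * sqrt k)\<close>; the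
  hypothesis on \<open>c\<close> turns this into the required form.\<close>

lemma prob_published_large_single_site:
  assumes "m = 1" "16 * real k * c < 1"
  shows "measure_pmf.prob (hyz_run k \<epsilon> adv n) {(s, h). pub s - real n > c * sqrt (real k) * \<epsilon> * real n}
    \<ge> 1 - exp (- 1 / 256)"
proof -
  define A where "A = {(s :: hyz_state, h :: real list, r). (\<Sum>j<m. r j :: nat) \<le> n - lag}"
  define S where "S = {(s :: hyz_state, h :: real list, r :: nat \<Rightarrow> nat). pub s - real n > c * sqrt (real k) * \<epsilon> * real n}"
  have A: "measure_pmf.prob (run' n) A \<le> exp (- 1 / 256)"
    using prob_no_recent_report_lag by (simp add: A_def assms(1))
  have "measure_pmf.prob (run' n) (- A) \<le> measure_pmf.prob (run' n) S"
  proof (rule measure_pmf.finite_measure_mono_AE)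
    show "AE x in run' n. x \<in> - A \<longrightarrow> x \<in> S"
    proof (intro AE_pmfI impI)
      fix x assume x: "x \<in> set_pmf (run' n)" "x \<in> - A"
      obtain s h r where xx: "x = (s, h, r)" by (cases x)
      have a: "n - lag < r 0" using x by (auto simp: A_def xx assms(1))
      then have "pub s \<ge> real (r 0) + gain"
        using x lag(3) by (intro published_ge_single_site[OF assms(1), of s h r n]) (auto simp: xx ws_def)
      moreover have "real n - real lag < real (r 0)" using a by linarith
      ultimately have "pub s - real n > gain - real lag" by linarith
      moreover have "1 \<le> 1 / (8 * pmax)" using pmax by (simp add: divide_simps)
      ultimately have "pub s - real n > 1 / pmax / 2" using lag(1) pmax(1) by (simp add: gain_def assms(1) field_simps)
      moreover have "1 / pmax / 2 = \<epsilon> * real n / (16 * sqrt (real k))" by (simp add: inverse_pmax)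
      moreover have "c * sqrt (real k) * \<epsilon> * real n \<le> \<epsilon> * real n / (16 * sqrt (real k))"
      proof -
        have "c * sqrt (real k) * (16 * sqrt (real k)) = 16 * (sqrt (real k) * sqrt (real k)) * c"
          by (simp only: mult_ac)
        also have "\<dots> \<le> 1" using assms(2) by simp
        finally have "c * sqrt (real k) * (16 * sqrt (real k)) \<le> 1" .
        then have "c * sqrt (real k) \<le> 1 / (16 * sqrt (real k))" using k_pos by (simp add: pos_le_divide_eq)
        then have "c * sqrt (real k) * (\<epsilon> * real n) \<le> 1 / (16 * sqrt (real k)) * (\<epsilon> * real n)"
          using eps by (intro mult_right_mono) auto
        then show ?thesis by (simp add: mult_ac)
      qed
      ultimately show "x \<in> S" by (simp add: S_def xx)
    qed
  qed auto
  moreover have "measure_pmf.prob (run' n) (- A) = 1 - measure_pmf.prob (run' n) A"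
    using measure_pmf.prob_compl[of A "run' n"] by (simp add: Compl_eq_Diff_UNIV)
  ultimately have "1 - exp (- 1 / 256) \<le> measure_pmf.prob (run' n) S" using A by linarith
  then show ?thesis by (simp add: prob_run' S_def)
qed

end

section \<open>Choice of the constants\<close>

theorem mainTheorem1:
  shows "\<exists>c1 c2 c3 :: real. c1 > 0 \<and> c2 > 0 \<and> c3 > 0 \<and>
    (\<forall>(k::nat) (\<epsilon>::real). k \<ge> 1 \<longrightarrow> \<epsilon> > 0 \<longrightarrow> \<epsilon> \<le> 1 / sqrt (real k) \<longrightarrow>
      (\<exists>adv :: real list \<Rightarrow> nat. (\<forall>h. adv h < k) \<and>
        (\<forall>n::nat. real n > c3 * sqrt (real k) / \<epsilon> \<longrightarrow>
           measure_pmf.prob (hyz_run k \<epsilon> adv n)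
             {(s, h). pub s - real n > c1 * sqrt (real k) * \<epsilon> * real n}
           \<ge> 1 - exp (- c2 * real k))))"
proof -
  \<comment> \<open>From \<open>K = 6 * 6400000\<close> on, \<open>k / 6400000\<close> is at least
    6, which absorbs the factor \<open>17 \<le> exp 4\<close>.\<close>
  define K :: nat where "K = 38400000"
  \<comment> \<open>\<open>c1\<close> and \<open>c2\<close> are dictated by the case
    \<open>k < K\<close>: there \<open>16 * k * c1 < 1\<close> and \<open>c2 * k < 1 / 256\<close>,
    so the constant failure probability \<open>exp (- 1 / 256)\<close> suffices.\<close>
  define c1 :: real where "c1 = 1 / (32 * real K)"
  define c2 :: real where "c2 = 1 / (256 * real K)"
  have "\<exists>adv :: real list \<Rightarrow> nat. (\<forall>h. adv h < k) \<and>
        (\<forall>n::nat. real n > 64 * sqrt (real k) / \<epsilon> \<longrightarrow>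
           measure_pmf.prob (hyz_run k \<epsilon> adv n)
             {(s, h). pub s - real n > c1 * sqrt (real k) * \<epsilon> * real n}
           \<ge> 1 - exp (- c2 * real k))"
    if k: "k \<ge> 1" and eps: "\<epsilon> > 0" "\<epsilon> \<le> 1 / sqrt (real k)" for k :: nat and \<epsilon> :: real
  proof -
    define m where "m = (if k < K then 1 else k div 16)"
    interpret round_robin k m \<epsilon>
      using k eps by unfold_locales (auto simp: m_def K_def)
    show ?thesis
    proof (intro exI[of _ adv] conjI allI impI)
      fix h show "adv h < k" using adv_less[of h] m by simp
    next
      fix n :: nat assume n: "real n > 64 * sqrt (real k) / \<epsilon>"
      interpret window k m \<epsilon> n using n by unfold_locales
      show "1 - exp (- c2 * real k) \<le> measure_pmf.prob (hyz_run k \<epsilon> adv n)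
             {(s, h). pub s - real n > c1 * sqrt (real k) * \<epsilon> * real n}"
      proof (cases "k < K")
        case True
        have "exp (- 1 / 256) \<le> exp (- c2 * real k)" using True by (simp add: c2_def K_def)
        moreover have "1 - exp (- 1 / 256) \<le> measure_pmf.prob (hyz_run k \<epsilon> adv n)
             {(s, h). pub s - real n > c1 * sqrt (real k) * \<epsilon> * real n}"
          using True by (intro prob_published_large_single_site) (auto simp: m_def c1_def K_def)
        ultimately show ?thesis by linarith
      next
        case False
        have mk: "16 * m \<le> k" "k \<le> 32 * m" using False by (auto simp: m_def K_def)
        have "exp (3 :: real) = exp 1 ^ 3" by (simp flip: exp_of_nat_mult)
        moreover have "(5 / 2 :: real) ^ 3 \<le> exp 1 ^ 3"
          using exp_lower_Taylor_quadratic[of "1 :: real"] by (intro power_mono) auto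
        ultimately have "15 \<le> exp (3 :: real)" by (simp add: power3_eq_cube)
        moreover have "exp (3 :: real) * 2 \<le> exp 4"
          using exp_ge_add_one_self[of "1 :: real"] exp_add[of "3 :: real" 1] by simp
        ultimately have e4: "17 \<le> exp (4 :: real)" by linarith
        have "17 * exp (- real k / 6400000) \<le> exp 4 * exp (- real k / 6400000)"
          using e4 by (intro mult_right_mono) auto
        also have "\<dots> = exp (4 - real k / 6400000)" by (simp flip: exp_add)
        also have "\<dots> \<le> exp (- c2 * real k)" using False by (simp add: c2_def K_def)
        finally have e: "17 * exp (- real k / 6400000) \<le> exp (- c2 * real k)" .
        have "1 - 17 * exp (- real k / 6400000) \<le> measure_pmf.prob (hyz_run k \<epsilon> adv n)
             {(s, h). pub s - real n > sqrt (real k) * \<epsilon> * real n / 512}"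
          by (rule prob_published_large[OF mk])
        also have "\<dots> \<le> measure_pmf.prob (hyz_run k \<epsilon> adv n)
             {(s, h). pub s - real n > c1 * sqrt (real k) * \<epsilon> * real n}"
        proof (rule measure_pmf.finite_measure_mono)
          have "c1 * (sqrt (real k) * \<epsilon> * real n) \<le> 1 / 512 * (sqrt (real k) * \<epsilon> * real n)"
            using eps by (intro mult_right_mono) (auto simp: c1_def K_def)
          then have "c1 * sqrt (real k) * \<epsilon> * real n \<le> sqrt (real k) * \<epsilon> * real n / 512" by (simp add: mult_ac)
          then show "{(s :: hyz_state, h :: real list). pub s - real n > sqrt (real k) * \<epsilon> * real n / 512} \<subseteq>
            {(s, h). pub s - real n > c1 * sqrt (real k) * \<epsilon> * real n}" by auto
        qed simp
        finally show ?thesis using e by linarith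
      qed
    qed
  qed
  moreover have "c1 > 0" "c2 > 0" by (auto simp: c1_def c2_def K_def)
  ultimately show ?thesis by (intro exI[of _ c1] exI[of _ c2] exI[of _ 64]) auto
qed

end
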